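(* Let $G$ be a finite graph on $n$ vertices $\{x_1,\ldots,x_n\}$ (no loops, no multiple edges, no isolated vertices) and let $\mathfrak{c}=(c_1,\ldots,c_n)\in\mathbb{Z}_{>0}^n$. Suppose that each connected component of $G$ is of the form $K-M$, where $K$ is a complete multipartite graph and $M$ is a matching of $K$ (and $K-M$ denotes the graph obtained from $K$ by removing the edges of $M$). Then the toric ideal of $\mathcal{B}(G,\mathfrak{c})$ is generated by symmetric exchange binomials.
   Context: Let $S=K[x_1,\ldots,x_n]$ over a field $K$ and let $I(G)$ be the edge ideal of $G$, generated by $x_ix_j$ for each edge $\{x_i,x_j\}$. For $q\geq1$ and $\mathfrak{c}\in\mathbb{Z}_{>0}^n$, $(I(G)^q)_{\mathfrak{c}}$ denotes the monomial ideal generated by the monomials $x_1^{a_1}\cdots x_n^{a_n}\in I(G)^q$ with $a_i\leq c_i$ for all $i$; $\delta_{\mathfrak{c}}(I(G))$ is the largest $q$ with $(I(G)^q)_{\mathfrak{c}}\neq(0)$; and $\mathcal{B}(G,\mathfrak{c})$ is the minimal set of monomial generators of $(I(G)^{\delta_{\mathfrak{c}}(I(G))})_{\mathfrak{c}}$ (it is known to be a polymatroid). For a finite set of monomials $\mathcal{B}=\{w_1,\ldots,w_s\}$, let $T=K[z_1,\ldots,z_s]$ and $\pi:T\to K[w_1,\ldots,w_s]$ with $\pi(z_i)=w_i$; the toric ideal is $J_{\mathcal{B}}=\ker\pi$. A symmetric exchange binomial of $\mathcal{B}$ is a binomial $z_iz_j-z_{i_0}z_{j_0}$ where $w_i=x_1^{a_1}\cdots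 x_n^{a_n}$, $w_j=x_1^{b_1}\cdots x_n^{b_n}$, and there are indices $\xi,\rho$ with $a_\xi>b_\xi$, $a_\rho<b_\rho$ such that $w_{i_0}=x_\rho w_i/x_\xi$ and $w_{j_0}=x_\xi w_j/x_\rho$ both belong to $\mathcal{B}$. A complete multipartite graph is a graph whose vertex set is partitioned into $m\geq2$ nonempty parts, with edges exactly the pairs of vertices in different parts. A matching is a set of pairwise disjoint edges. *)

theory Defs
  imports "HOL-Library.Poly_Mapping" "HOL-Library.Disjoint_Sets"
begin

text \<open>A monomial in the variables indexed by 'v is an exponent vector 'v =>0 nat;
  a polynomial over the field 'k is a finitely supported map from monomials to 'k
  (multiplication is convolution, so this is the polynomial ring).\<close>

definition xmon :: "('v \<Rightarrow>\<^sub>0 nat) \<Rightarrow> (('v \<Rightarrow>\<^sub>0 nat) \<Rightarrow>\<^sub>0 'k::comm_ring_1)" where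
  "xmon a = Poly_Mapping.single a 1"

definition xvar :: "'v \<Rightarrow> (('v \<Rightarrow>\<^sub>0 nat) \<Rightarrow>\<^sub>0 'k::comm_ring_1)" where
  "xvar v = xmon (Poly_Mapping.single v 1)"

text \<open>Componentwise divisibility of monomials (the order on poly_mapping is lexicographic,
  so we do not use it).\<close>
definition mdvd :: "('v \<Rightarrow>\<^sub>0 nat) \<Rightarrow> ('v \<Rightarrow>\<^sub>0 nat) \<Rightarrow> bool" where
  "mdvd a b \<longleftrightarrow> (\<forall>v. Poly_Mapping.lookup a v \<le> Poly_Mapping.lookup b v)"

text \<open>The ideal of the subring R generated by S (finite R-linear combinations);
  with R = UNIV this is the usual ideal generated by S.\<close>
definition ideal_span :: "'a::comm_ring_1 set \<Rightarrow> 'a set \<Rightarrow> 'a set" where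
  "ideal_span R S = {p. \<exists>F c. finite F \<and> F \<subseteq> S \<and> (\<forall>s\<in>F. c s \<in> R) \<and> p = (\<Sum>s\<in>F. c s * s)}"

fun ideal_pow :: "'a::comm_ring_1 set \<Rightarrow> nat \<Rightarrow> 'a set" where
  "ideal_pow J 0 = UNIV"
| "ideal_pow J (Suc q) = ideal_span UNIV {a * b | a b. a \<in> J \<and> b \<in> ideal_pow J q}"

definition edge_ideal :: "'v set set \<Rightarrow> (('v \<Rightarrow>\<^sub>0 nat) \<Rightarrow>\<^sub>0 'k::field) set" where
  "edge_ideal E = ideal_span UNIV {xvar u * xvar v | u v. {u, v} \<in> E}"

definition trunc :: "(('v \<Rightarrow>\<^sub>0 nat) \<Rightarrow>\<^sub>0 'k::field) set \<Rightarrow> ('v \<Rightarrow> nat) \<Rightarrow> (('v \<Rightarrow>\<^sub>0 nat) \<Rightarrow>\<^sub>0 'k) set" where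
  "trunc J c = ideal_span UNIV {xmon a | a. xmon a \<in> J \<and> (\<forall>v. Poly_Mapping.lookup a v \<le> c v)}"

definition delta :: "(('v \<Rightarrow>\<^sub>0 nat) \<Rightarrow>\<^sub>0 'k::field) set \<Rightarrow> ('v \<Rightarrow> nat) \<Rightarrow> nat" where
  "delta I c = (GREATEST q. trunc (ideal_pow I q) c \<noteq> {0})"

definition mingens :: "(('v \<Rightarrow>\<^sub>0 nat) \<Rightarrow>\<^sub>0 'k::field) set \<Rightarrow> ('v \<Rightarrow>\<^sub>0 nat) set" where
  "mingens J = {a. xmon a \<in> J \<and> (\<forall>b. xmon b \<in> J \<and> mdvd b a \<longrightarrow> b = a)}"

definition Bset :: "(('v \<Rightarrow>\<^sub>0 nat) \<Rightarrow>\<^sub>0 'k::field) set \<Rightarrow> ('v \<Rightarrow> nat) \<Rightarrow> ('v \<Rightarrow>\<^sub>0 nat) set" where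
  "Bset I c = mingens (trunc (ideal_pow I (delta I c)) c)"

text \<open>T = K[z_w : w in B]: polynomials in variables indexed by monomials w, using only w in B.\<close>
definition Tring :: "('m set) \<Rightarrow> (('m \<Rightarrow>\<^sub>0 nat) \<Rightarrow>\<^sub>0 'k::comm_ring_1) set" where
  "Tring B = {p. \<forall>\<beta>\<in>Poly_Mapping.keys p. Poly_Mapping.keys \<beta> \<subseteq> B}"

definition zmon :: "('m \<Rightarrow>\<^sub>0 nat) \<Rightarrow> (('m \<Rightarrow>\<^sub>0 nat) \<Rightarrow>\<^sub>0 'k::comm_ring_1)" where
  "zmon \<beta> = Poly_Mapping.single \<beta> 1"

definition toric_pi :: "((('v \<Rightarrow>\<^sub>0 nat) \<Rightarrow>\<^sub>0 nat) \<Rightarrow>\<^sub>0 'k::field) \<Rightarrow> (('v \<Rightarrow>\<^sub>0 nat) \<Rightarrow>\<^sub>0 'k)" where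
  "toric_pi p = (\<Sum>\<beta>\<in>Poly_Mapping.keys p. Poly_Mapping.single 0 (Poly_Mapping.lookup p \<beta>) * (\<Prod>w\<in>Poly_Mapping.keys \<beta>. (xmon w) ^ (Poly_Mapping.lookup \<beta> w)))"

definition toric_ideal :: "('v \<Rightarrow>\<^sub>0 nat) set \<Rightarrow> ((('v \<Rightarrow>\<^sub>0 nat) \<Rightarrow>\<^sub>0 nat) \<Rightarrow>\<^sub>0 'k::field) set" where
  "toric_ideal B = {p \<in> Tring B. toric_pi p = 0}"

text \<open>Symmetric exchange binomials z_i z_j - z_i0 z_j0, with w_i0 = x_rho w_i / x_xi and
  w_j0 = x_xi w_j / x_rho (division written multiplicatively on exponent vectors).\<close>
definition sym_exch :: "('v \<Rightarrow>\<^sub>0 nat) set \<Rightarrow> ((('v \<Rightarrow>\<^sub>0 nat) \<Rightarrow>\<^sub>0 nat) \<Rightarrow>\<^sub>0 'k::field) set" where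
  "sym_exch B = {zmon (Poly_Mapping.single wi 1 + Poly_Mapping.single wj 1)
                 - zmon (Poly_Mapping.single wi0 1 + Poly_Mapping.single wj0 1) | wi wj wi0 wj0.
      wi \<in> B \<and> wj \<in> B \<and> wi0 \<in> B \<and> wj0 \<in> B \<and>
      (\<exists>\<xi> \<rho>. Poly_Mapping.lookup wi \<xi> > Poly_Mapping.lookup wj \<xi> \<and> Poly_Mapping.lookup wi \<rho> < Poly_Mapping.lookup wj \<rho> \<and>
         wi0 + Poly_Mapping.single \<xi> 1 = wi + Poly_Mapping.single \<rho> 1 \<and>
         wj0 + Poly_Mapping.single \<rho> 1 = wj + Poly_Mapping.single \<xi> 1)}"

definition simple_graph :: "'v set set \<Rightarrow> bool" where
  "simple_graph E \<longleftrightarrow> (\<forall>e\<in>E. card e = 2)"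

definition no_isolated :: "'v set set \<Rightarrow> bool" where
  "no_isolated E \<longleftrightarrow> (\<forall>v. \<exists>e\<in>E. v \<in> e)"

definition adj :: "'v set set \<Rightarrow> 'v \<Rightarrow> 'v \<Rightarrow> bool" where
  "adj E u v \<longleftrightarrow> {u, v} \<in> E"

definition component :: "'v set set \<Rightarrow> 'v \<Rightarrow> 'v set" where
  "component E v = {u. (adj E)\<^sup>*\<^sup>* v u}"

definition cmp_edges :: "'v set set \<Rightarrow> 'v set set" where
  "cmp_edges P = {{u, v} | u v. \<exists>A\<in>P. \<exists>B\<in>P. A \<noteq> B \<and> u \<in> A \<and> v \<in> B}"

definition is_matching :: "'v set set \<Rightarrow> bool" where
  "is_matching M \<longleftrightarrow> (\<forall>e\<in>M. \<forall>f\<in>M. e \<noteq> f \<longrightarrow> e \<inter> f = {})"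

definition cmp_minus_matching :: "'v set set \<Rightarrow> 'v set \<Rightarrow> bool" where
  "cmp_minus_matching E C \<longleftrightarrow>
     (\<exists>P M. partition_on C P \<and> card P \<ge> 2 \<and> M \<subseteq> cmp_edges P \<and> is_matching M \<and>
            {e \<in> E. e \<subseteq> C} = cmp_edges P - M)"

end

(*
Elements of B(G,c) are the degree vectors of maximum c-bounded multisets H of edges.
Inside one component K - M they satisfy the strong exchange property: if u_i > v_i and
u_j < v_j, then u - e_i + e_j is again in B. When H leaves at most one unit of capacity
unused in the component, u - e_i + e_j agrees there with v. Otherwise the absence of short augmenting
paths yields a stable set S (a part of K or an edge of M) such that the rest of the component
is saturated and every edge of H crosses; rerouting at most two edges of H then moves a
unit from i to j.

For a fiber of the toric map, exchanges first make a multiset of elements of B balanced (all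
values in a column differ by at most one), since they decrease the sum of squares. Two balanced
multisets with equal column sums are 0/1 matrices after subtracting the column minima, and these
are connected by switches, made in either of the two matrices so that their first rows approach
each other.
*)
theory Submission
  imports Defs "HOL-Library.Multiset"
begin

section \<open>Symmetric exchange on multisets of vectors\<close>

text \<open>For polymatroids in general, generation of the toric ideal by symmetric exchanges is an
  open conjecture. The usual exchange axiom grants some index \<open>j\<close>; here
  \<open>j\<close> is prescribed, so an exchange can be aimed at a chosen pair of columns, which the
  switches require. The price is that \<open>i\<close> and \<open>j\<close> must lie in one
  component: the weight on each component is constant on \<open>B\<close>, so no unit can cross
  between components. Deleting a matching from K is harmless because every vertex loses at most one
  neighbour across the parts. A missing edge therefore blocks a rerouting for at most one vertex of
  a part, and a second vertex of that part, or the reverse orientation of an edge of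
  \<open>H\<close>, takes over.\<close>

abbreviation wt :: "('v::finite \<Rightarrow>\<^sub>0 nat) \<Rightarrow> 'v set \<Rightarrow> nat" where
  "wt u C \<equiv> (\<Sum>x\<in>C. Poly_Mapping.lookup u x)"

text \<open>This congruence mirrors membership of a binomial in the ideal: \<open>sym\<close> and
  \<open>trans\<close> are negation and addition, \<open>add\<close> is multiplication by a
  monomial. \<open>L\<close> stays inside \<open>B\<close> because the ideal is formed in the ring
  with variables \<open>z_w\<close>, \<open>w\<close> in \<open>B\<close>.\<close>

inductive exch_equiv :: "('v \<Rightarrow>\<^sub>0 nat) set \<Rightarrow> ('v \<Rightarrow>\<^sub>0 nat) multiset \<Rightarrow> ('v \<Rightarrow>\<^sub>0 nat) multiset \<Rightarrow> bool"
  for B where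
  exch: "\<lbrakk>u \<in> B; v \<in> B; u' \<in> B; v' \<in> B;
     Poly_Mapping.lookup u i > Poly_Mapping.lookup v i; Poly_Mapping.lookup u j < Poly_Mapping.lookup v j;
     u' + Poly_Mapping.single i 1 = u + Poly_Mapping.single j 1;
     v' + Poly_Mapping.single j 1 = v + Poly_Mapping.single i 1\<rbrakk>
   \<Longrightarrow> exch_equiv B {#u, v#} {#u', v'#}"
| refl: "exch_equiv B M M"
| sym: "exch_equiv B M N \<Longrightarrow> exch_equiv B N M"
| trans: "exch_equiv B M N \<Longrightarrow> exch_equiv B N L \<Longrightarrow> exch_equiv B M L"
| add: "exch_equiv B M N \<Longrightarrow> set_mset L \<subseteq> B \<Longrightarrow> exch_equiv B (M + L) (N + L)"

text \<open>The labelling \<open>\<kappa>\<close> encodes the blocks as its fibres; it will be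
  instantiated by \<open>component E\<close>.\<close>

definition strong_exch :: "('v::finite \<Rightarrow>\<^sub>0 nat) set \<Rightarrow> ('v \<Rightarrow> 'b) \<Rightarrow> bool" where
  "strong_exch B \<kappa> \<longleftrightarrow>
     (\<forall>u\<in>B. \<forall>v\<in>B. \<forall>i. wt u {x. \<kappa> x = \<kappa> i} = wt v {x. \<kappa> x = \<kappa> i}) \<and>
     (\<forall>u\<in>B. \<forall>v\<in>B. \<forall>i j. \<kappa> j = \<kappa> i \<longrightarrow> Poly_Mapping.lookup u i > Poly_Mapping.lookup v i \<longrightarrow>
        Poly_Mapping.lookup u j < Poly_Mapping.lookup v j \<longrightarrow>
        (\<exists>u'\<in>B. u' + Poly_Mapping.single i 1 = u + Poly_Mapping.single j 1))"

lemma strong_exch_wt: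
  assumes "strong_exch B \<kappa>" "u \<in> B" "v \<in> B"
  shows "wt u {x. \<kappa> x = \<kappa> i} = wt v {x. \<kappa> x = \<kappa> i}"
  using assms unfolding strong_exch_def by blast

lemma strong_exchD:
  assumes "strong_exch B \<kappa>" "u \<in> B" "v \<in> B" "\<kappa> j = \<kappa> i"
    "Poly_Mapping.lookup u i > Poly_Mapping.lookup v i" "Poly_Mapping.lookup u j < Poly_Mapping.lookup v j"
  obtains u' where "u' \<in> B" "u' + Poly_Mapping.single i 1 = u + Poly_Mapping.single j 1"
  using assms(1)[unfolded strong_exch_def, THEN conjunct2, rule_format, OF assms(2-)] by (elim bexE)

lemma strong_exch_opposite:
  assumes "strong_exch B \<kappa>" "u \<in> B" "v \<in> B" "Poly_Mapping.lookup u i > Poly_Mapping.lookup v i"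
  obtains j where "\<kappa> j = \<kappa> i" "Poly_Mapping.lookup u j < Poly_Mapping.lookup v j"
proof -
  have "\<exists>j. \<kappa> j = \<kappa> i \<and> Poly_Mapping.lookup u j < Poly_Mapping.lookup v j"
  proof (rule ccontr)
    assume "\<not> ?thesis"
    then have "wt v {x. \<kappa> x = \<kappa> i} < wt u {x. \<kappa> x = \<kappa> i}"
      using assms(4) by (intro sum_strict_mono_ex1) (auto simp: not_less)
    then show False using strong_exch_wt[OF assms(1-3), of i] by simp
  qed
  then show thesis using that by blast
qed

lemma lookup_shift:
  fixes u :: "'v \<Rightarrow>\<^sub>0 nat"
  assumes "u' + Poly_Mapping.single i 1 = u + Poly_Mapping.single j 1"
  shows "int (Poly_Mapping.lookup u' x) = int (Poly_Mapping.lookup u x) - of_bool (x = i) + of_bool (x = j)"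
  using arg_cong[OF assms, of "\<lambda>p. int (Poly_Mapping.lookup p x)"]
  by (auto simp: lookup_add lookup_single when_def of_bool_def split: if_splits)

text \<open>The one-sided property yields both halves of a symmetric exchange: use it for
  \<open>u\<close>, \<open>v\<close> with \<open>i\<close>, \<open>j\<close>, then for
  \<open>v\<close>, \<open>u\<close> with \<open>j\<close>, \<open>i\<close>.\<close>

lemma strong_exch_swap:
  assumes "strong_exch B \<kappa>" "u \<in> B" "v \<in> B" "\<kappa> j = \<kappa> i"
    "Poly_Mapping.lookup u i > Poly_Mapping.lookup v i" "Poly_Mapping.lookup u j < Poly_Mapping.lookup v j"
  obtains u' v' where "u' \<in> B" "v' \<in> B" "exch_equiv B {#u, v#} {#u', v'#}" "u' + v' = u + v"
    "\<And>x. int (Poly_Mapping.lookup u' x) = int (Poly_Mapping.lookup u x) - of_bool (x = i) + of_bool (x = j)"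
    "\<And>x. int (Poly_Mapping.lookup v' x) = int (Poly_Mapping.lookup v x) + of_bool (x = i) - of_bool (x = j)"
proof -
  obtain u' where u': "u' \<in> B" "u' + Poly_Mapping.single i 1 = u + Poly_Mapping.single j 1"
    using strong_exchD[OF assms] by blast
  obtain v' where v': "v' \<in> B" "v' + Poly_Mapping.single j 1 = v + Poly_Mapping.single i 1"
    using strong_exchD[OF assms(1,3,2) assms(4)[symmetric] assms(6,5)] by blast
  have lu: "int (Poly_Mapping.lookup u' x) = int (Poly_Mapping.lookup u x) - of_bool (x = i) + of_bool (x = j)" for x
    by (rule lookup_shift[OF u'(2)])
  have lv: "int (Poly_Mapping.lookup v' x) = int (Poly_Mapping.lookup v x) + of_bool (x = i) - of_bool (x = j)" for x
    using lookup_shift[OF v'(2), of x] by simp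
  have s: "u' + v' = u + v"
    by (rule poly_mapping_eqI) (use lu lv in \<open>simp add: lookup_add flip: of_nat_eq_iff[where 'a = int]\<close>)
  show thesis
    using that[OF u'(1) v'(1) exch_equiv.exch[OF assms(2,3) u'(1) v'(1) assms(5,6) u'(2) v'(2)] s lu lv] .
qed

section \<open>Balancing the columns of a multiset\<close>

lemma sum_lookup_mset: "Poly_Mapping.lookup (\<Sum>\<^sub># M) x = (\<Sum>w\<in>#M. Poly_Mapping.lookup w x)"
  by (induction M) (auto simp: lookup_add)

text \<open>The sum of the two squares changes by \<open>-2 * (a i - b i - 1)\<close> at
  \<open>i\<close> and by \<open>-2 * (b j - a j - 1)\<close> at \<open>j\<close>. So a gap of two
  at \<open>i\<close> gives the strict decrease, and at \<open>j\<close> a gap of one already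
  prevents an increase.\<close>

lemma sum_squares_decrease:
  fixes a b a' b' :: "'v::finite \<Rightarrow> int"
  assumes "i \<noteq> j" "a i \<ge> b i + 2" "a j < b j"
    and a': "\<And>x. a' x = a x - of_bool (x = i) + of_bool (x = j)"
    and b': "\<And>x. b' x = b x + of_bool (x = i) - of_bool (x = j)"
  shows "(\<Sum>x\<in>UNIV. (a' x)\<^sup>2 + (b' x)\<^sup>2) < (\<Sum>x\<in>UNIV. (a x)\<^sup>2 + (b x)\<^sup>2)"
proof (rule sum_strict_mono_ex1)
  have vals: "a' i = a i - 1" "b' i = b i + 1" "a' j = a j + 1" "b' j = b j - 1"
    using a'[of i] b'[of i] a'[of j] b'[of j] \<open>i \<noteq> j\<close> by auto
  have i: "(a' i)\<^sup>2 + (b' i)\<^sup>2 = (a i)\<^sup>2 + (b i)\<^sup>2 - 2 * (a i - b i - 1)"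
    by (simp add: vals power2_eq_square algebra_simps)
  have j: "(a' j)\<^sup>2 + (b' j)\<^sup>2 = (a j)\<^sup>2 + (b j)\<^sup>2 - 2 * (b j - a j - 1)"
    by (simp add: vals power2_eq_square algebra_simps)
  show "\<forall>x\<in>UNIV. (a' x)\<^sup>2 + (b' x)\<^sup>2 \<le> (a x)\<^sup>2 + (b x)\<^sup>2"
  proof
    fix x
    show "(a' x)\<^sup>2 + (b' x)\<^sup>2 \<le> (a x)\<^sup>2 + (b x)\<^sup>2"
      using i j assms(2,3) a' b' by (cases "x = i"; cases "x = j") auto
  qed
  show "\<exists>x\<in>UNIV. (a' x)\<^sup>2 + (b' x)\<^sup>2 < (a x)\<^sup>2 + (b x)\<^sup>2"
    using i assms(2) by (intro bexI[of _ i]) auto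
qed auto

abbreviation energy :: "('v::finite \<Rightarrow>\<^sub>0 nat) multiset \<Rightarrow> int" where
  "energy M \<equiv> (\<Sum>w\<in>#M. \<Sum>x\<in>UNIV. (int (Poly_Mapping.lookup w x))\<^sup>2)"

lemma energy_nonneg: "energy M \<ge> 0"
  by (induction M) (auto intro!: sum_nonneg add_nonneg_nonneg)

lemma exch_equiv_balanced:
  assumes B: "strong_exch B \<kappa>" and "set_mset M \<subseteq> B"
  obtains N where "exch_equiv B M N" "set_mset N \<subseteq> B" "\<Sum>\<^sub># N = \<Sum>\<^sub># M" "size N = size M"
    "\<And>u v i. u \<in># N \<Longrightarrow> v \<in># N \<Longrightarrow> Poly_Mapping.lookup u i \<le> Poly_Mapping.lookup v i + 1"
proof -
  have "\<exists>N. exch_equiv B M N \<and> set_mset N \<subseteq> B \<and> \<Sum>\<^sub># N = \<Sum>\<^sub># M \<and> size N = size M \<and>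
    (\<forall>u\<in>#N. \<forall>v\<in>#N. \<forall>i. Poly_Mapping.lookup u i \<le> Poly_Mapping.lookup v i + 1)"
    using assms(2)
  proof (induction "nat (energy M)" arbitrary: M rule: less_induct)
    case less
    show ?case
    proof (cases "\<forall>u\<in>#M. \<forall>v\<in>#M. \<forall>i. Poly_Mapping.lookup u i \<le> Poly_Mapping.lookup v i + 1")
      case True
      then show ?thesis using less.prems by (intro exI[of _ M]) (auto intro: exch_equiv.refl)
    next
      case False
      then obtain u v i where uv: "u \<in># M" "v \<in># M" "\<not> Poly_Mapping.lookup u i \<le> Poly_Mapping.lookup v i + 1"
        by blast
      then have "u \<noteq> v" by auto
      obtain L1 where L1: "M = add_mset u L1" using uv(1) by (metis mset_add)
      then have "v \<in># L1" using uv(2) \<open>u \<noteq> v\<close> by simp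
      then obtain L where "L1 = add_mset v L" by (metis mset_add)
      then have M: "M = {#u, v#} + L" using L1 by simp
      have uvB: "u \<in> B" "v \<in> B" and LB: "set_mset L \<subseteq> B" using less.prems M by auto
      have gt: "Poly_Mapping.lookup u i > Poly_Mapping.lookup v i" using uv(3) by simp
      \<comment> \<open>Equal weight on the block of \<open>i\<close> forces a compensating column
        \<open>j\<close>; its gap may be as small as one.\<close>
      obtain j where j: "\<kappa> j = \<kappa> i" "Poly_Mapping.lookup u j < Poly_Mapping.lookup v j"
        using strong_exch_opposite[OF B uvB gt] by blast
      obtain u' v' where uv': "u' \<in> B" "v' \<in> B" "exch_equiv B {#u, v#} {#u', v'#}" "u' + v' = u + v"
        and lu: "\<And>x. int (Poly_Mapping.lookup u' x) = int (Poly_Mapping.lookup u x) - of_bool (x = i) + of_bool (x = j)"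
        and lv: "\<And>x. int (Poly_Mapping.lookup v' x) = int (Poly_Mapping.lookup v x) + of_bool (x = i) - of_bool (x = j)"
        using strong_exch_swap[OF B uvB j(1) gt j(2)] by blast
      let ?M' = "{#u', v'#} + L"
      have "(\<Sum>x\<in>UNIV. (int (Poly_Mapping.lookup u' x))\<^sup>2 + (int (Poly_Mapping.lookup v' x))\<^sup>2)
          < (\<Sum>x\<in>UNIV. (int (Poly_Mapping.lookup u x))\<^sup>2 + (int (Poly_Mapping.lookup v x))\<^sup>2)"
        by (rule sum_squares_decrease[OF _ _ _ lu lv]) (use uv(3) j gt in auto)
      then have "energy ?M' < energy M" by (simp add: M sum.distrib)
      moreover have "energy ?M' \<ge> 0" by (rule energy_nonneg)
      ultimately have "nat (energy ?M') < nat (energy M)" by linarith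
      moreover have "set_mset ?M' \<subseteq> B" using uv' LB by auto
      ultimately obtain N where N: "exch_equiv B ?M' N" "set_mset N \<subseteq> B" "\<Sum>\<^sub># N = \<Sum>\<^sub># ?M'" "size N = size ?M'"
        "\<forall>u\<in>#N. \<forall>v\<in>#N. \<forall>i. Poly_Mapping.lookup u i \<le> Poly_Mapping.lookup v i + 1"
        using less.hyps[of ?M'] by blast
      have "exch_equiv B M ?M'" unfolding M by (rule exch_equiv.add[OF uv'(3) LB])
      moreover have "\<Sum>\<^sub># ?M' = \<Sum>\<^sub># M" using uv'(4) by (simp add: M flip: add.assoc)
      ultimately show ?thesis using N M by (intro exI[of _ N]) (auto intro: exch_equiv.trans)
    qed
  qed
  then show thesis using that by blast
qed

text \<open>The integer average of a balanced family is its minimum. The two admissible values thus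
  depend only on sum and size, so two balanced multisets in the same fiber have the same
  ones.\<close>

lemma balanced_between:
  assumes x: "x \<in># M"
    and bal: "\<And>u v. u \<in># M \<Longrightarrow> v \<in># M \<Longrightarrow> f u \<le> f v + (1::nat)"
  shows "(\<Sum>w\<in>#M. f w) div size M \<le> f x" "f x \<le> (\<Sum>w\<in>#M. f w) div size M + 1"
proof -
  have fin: "finite (f ` set_mset M)" "f ` set_mset M \<noteq> {}" using x by auto
  define m where "m = Min (f ` set_mset M)"
  obtain y where y: "y \<in># M" "f y = m" using Min_in[OF fin] by (auto simp: m_def)
  have lo: "\<And>w. w \<in># M \<Longrightarrow> m \<le> f w" using fin by (simp add: m_def)
  have hi: "\<And>w. w \<in># M \<Longrightarrow> f w \<le> m + 1" using bal y by metis
  \<comment> \<open>Splitting off the minimiser \<open>y\<close> makes the upper bound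
    \<open>size M * (m + 1)\<close> strict.\<close>
  obtain L where L: "M = add_mset y L" using y(1) by (metis mset_add)
  have "(\<Sum>w\<in>#M. m) \<le> (\<Sum>w\<in>#M. f w)" by (rule sum_mset_mono) (use lo in auto)
  moreover have "(\<Sum>w\<in>#L. f w) \<le> (\<Sum>w\<in>#L. m + 1)" by (rule sum_mset_mono) (use hi L in auto)
  ultimately have "size M * m \<le> (\<Sum>w\<in>#M. f w)" "(\<Sum>w\<in>#M. f w) < size M * (m + 1)"
    using y L by (simp_all add: sum_mset_constant algebra_simps)
  then have "(\<Sum>w\<in>#M. f w) div size M = m"
    by (metis add.commute div_nat_eqI mult.commute plus_1_eq_Suc)
  then show "(\<Sum>w\<in>#M. f w) div size M \<le> f x" "f x \<le> (\<Sum>w\<in>#M. f w) div size M + 1"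
    using lo hi x by auto
qed

section \<open>Connecting balanced multisets by switches\<close>

definition levels :: "('v \<Rightarrow> nat) \<Rightarrow> ('v \<Rightarrow>\<^sub>0 nat) multiset \<Rightarrow> bool" where
  "levels q M \<longleftrightarrow> (\<forall>w\<in>#M. \<forall>x. q x \<le> Poly_Mapping.lookup w x \<and> Poly_Mapping.lookup w x \<le> q x + 1)"

text \<open>In columns \<open>i\<close> and \<open>j\<close> the rows \<open>u\<close> and
  \<open>w\<close> form opposite corners of a 2 by 2 minor, so the exchange only interchanges the
  values \<open>q\<close> and \<open>q + 1\<close> and cannot leave the levels.\<close>

lemma levels_swap:
  assumes B: "strong_exch B \<kappa>" and MB: "set_mset (add_mset u M) \<subseteq> B" "levels q (add_mset u M)"
    and w: "w \<in># M" and ij: "\<kappa> j = \<kappa> i"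
    and i: "Poly_Mapping.lookup u i = q i + 1" "Poly_Mapping.lookup w i = q i"
    and j: "Poly_Mapping.lookup u j = q j" "Poly_Mapping.lookup w j = q j + 1"
  obtains u' M' where "exch_equiv B (add_mset u M) (add_mset u' M')" "set_mset (add_mset u' M') \<subseteq> B"
    "levels q (add_mset u' M')" "\<Sum>\<^sub># (add_mset u' M') = \<Sum>\<^sub># (add_mset u M)" "size M' = size M"
    "Poly_Mapping.lookup u' i = q i" "Poly_Mapping.lookup u' j = q j + 1"
    "\<And>x. x \<noteq> i \<Longrightarrow> x \<noteq> j \<Longrightarrow> Poly_Mapping.lookup u' x = Poly_Mapping.lookup u x"
proof -
  obtain L where M: "M = add_mset w L" using w by (metis mset_add)
  have uB: "u \<in> B" and wB: "w \<in> B" and LB: "set_mset L \<subseteq> B" using MB(1) M by auto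
  have ineq: "i \<noteq> j" using i j by auto
  obtain u' w' where uw': "u' \<in> B" "w' \<in> B" "exch_equiv B {#u, w#} {#u', w'#}" "u' + w' = u + w"
    and lu: "\<And>x. int (Poly_Mapping.lookup u' x) = int (Poly_Mapping.lookup u x) - of_bool (x = i) + of_bool (x = j)"
    and lw: "\<And>x. int (Poly_Mapping.lookup w' x) = int (Poly_Mapping.lookup w x) + of_bool (x = i) - of_bool (x = j)"
    by (rule strong_exch_swap[OF B uB wB ij]) (use i j in simp_all)
  have vals: "Poly_Mapping.lookup u' i = q i" "Poly_Mapping.lookup u' j = q j + 1"
      "Poly_Mapping.lookup w' i = q i + 1" "Poly_Mapping.lookup w' j = q j"
    using lu[of i] lu[of j] lw[of i] lw[of j] i j ineq by auto
  have oth: "Poly_Mapping.lookup u' x = Poly_Mapping.lookup u x" "Poly_Mapping.lookup w' x = Poly_Mapping.lookup w x"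
    if "x \<noteq> i" "x \<noteq> j" for x
    using lu[of x] lw[of x] that by auto
  have "q x \<le> Poly_Mapping.lookup y x \<and> Poly_Mapping.lookup y x \<le> q x + 1" if "y = u' \<or> y = w'" for x y
    using MB(2) that vals oth[of x] unfolding levels_def M by (cases "x = i"; cases "x = j") auto
  then have lev: "levels q (add_mset u' (add_mset w' L))"
    using MB(2) unfolding levels_def M by auto
  have "exch_equiv B ({#u, w#} + L) ({#u', w'#} + L)" by (rule exch_equiv.add[OF uw'(3) LB])
  moreover have "\<Sum>\<^sub># (add_mset u' (add_mset w' L)) = \<Sum>\<^sub># (add_mset u M)"
    using uw'(4) by (simp add: M flip: add.assoc)
  ultimately show thesis
    using that[of u' "add_mset w' L"] M lev vals oth uw' LB by auto
qed

lemma exch_equiv_levels: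
  assumes B: "strong_exch B \<kappa>"
    and "set_mset M \<subseteq> B" "set_mset N \<subseteq> B" "levels q M" "levels q N" "\<Sum>\<^sub># M = \<Sum>\<^sub># N" "size M = size N"
  shows "exch_equiv B M N"
  using assms(2-)
proof (induction "size M" arbitrary: M N)
  case 0
  then show ?case by (simp add: exch_equiv.refl)
next
  case (Suc m)
  note IH = Suc.hyps(1)
  \<comment> \<open>The inner induction is on the number of columns where the chosen rows
    \<open>u\<close> and \<open>v\<close> differ. When they agree they are cancelled and the outer
    induction takes over.\<close>
  have first: "exch_equiv B (add_mset u M) (add_mset v N)"
    if "set_mset (add_mset u M) \<subseteq> B" "set_mset (add_mset v N) \<subseteq> B" "levels q (add_mset u M)" "levels q (add_mset v N)"
      "\<Sum>\<^sub># (add_mset u M) = \<Sum>\<^sub># (add_mset v N)" "size M = m" "size N = m" for u v M N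
    using that
  proof (induction "card {x. Poly_Mapping.lookup u x \<noteq> Poly_Mapping.lookup v x}" arbitrary: u v M N rule: less_induct)
    case less
    have uB: "u \<in> B" and vB: "v \<in> B" using less.prems by auto
    show ?case
    proof (cases "u = v")
      case True
      then have "exch_equiv B M N" using less.prems by (intro IH) (auto simp: levels_def)
      from exch_equiv.add[OF this, of "{#u#}"] show ?thesis using True uB by simp
    next
      case False
      then obtain x where x: "Poly_Mapping.lookup u x \<noteq> Poly_Mapping.lookup v x"
        by (meson poly_mapping_eqI)
      \<comment> \<open>Rows of equal block weight that differ do so in both directions inside a
        single block.\<close>
      have "\<exists>i j. \<kappa> j = \<kappa> i \<and> Poly_Mapping.lookup u i > Poly_Mapping.lookup v i \<and> Poly_Mapping.lookup u j < Poly_Mapping.lookup v j"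
      proof (cases "Poly_Mapping.lookup u x > Poly_Mapping.lookup v x")
        case True
        then show ?thesis using strong_exch_opposite[OF B uB vB True] by blast
      next
        case False
        then have "Poly_Mapping.lookup v x > Poly_Mapping.lookup u x" using x by simp
        then obtain i where "\<kappa> i = \<kappa> x" "Poly_Mapping.lookup v i < Poly_Mapping.lookup u i"
          using strong_exch_opposite[OF B vB uB] by blast
        then show ?thesis using \<open>Poly_Mapping.lookup v x > Poly_Mapping.lookup u x\<close> by metis
      qed
      then obtain i j where ij: "\<kappa> j = \<kappa> i" "Poly_Mapping.lookup u i > Poly_Mapping.lookup v i" "Poly_Mapping.lookup u j < Poly_Mapping.lookup v j"
        by blast
      have "q i \<le> Poly_Mapping.lookup v i" "Poly_Mapping.lookup u i \<le> q i + 1"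
           "q j \<le> Poly_Mapping.lookup u j" "Poly_Mapping.lookup v j \<le> q j + 1"
        using less.prems(3,4) by (auto simp: levels_def)
      with ij have vals: "Poly_Mapping.lookup u i = q i + 1" "Poly_Mapping.lookup v i = q i"
           "Poly_Mapping.lookup u j = q j" "Poly_Mapping.lookup v j = q j + 1" by auto
      show ?thesis
      proof (cases "\<exists>w\<in>#M. Poly_Mapping.lookup w i = q i \<and> Poly_Mapping.lookup w j = q j + 1")
        case True
        then obtain w where w: "w \<in># M" "Poly_Mapping.lookup w i = q i" "Poly_Mapping.lookup w j = q j + 1" by blast
        obtain u' M' where M': "exch_equiv B (add_mset u M) (add_mset u' M')" "set_mset (add_mset u' M') \<subseteq> B"
          "levels q (add_mset u' M')" "\<Sum>\<^sub># (add_mset u' M') = \<Sum>\<^sub># (add_mset u M)" "size M' = size M"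
          and u': "Poly_Mapping.lookup u' i = q i" "Poly_Mapping.lookup u' j = q j + 1"
          "\<And>x. x \<noteq> i \<Longrightarrow> x \<noteq> j \<Longrightarrow> Poly_Mapping.lookup u' x = Poly_Mapping.lookup u x"
          using levels_swap[OF B less.prems(1,3) w(1) ij(1) vals(1) w(2) vals(3) w(3)] by blast
        \<comment> \<open>The new row agrees with \<open>v\<close> at both \<open>i\<close> and
          \<open>j\<close> and is unchanged elsewhere.\<close>
        have "{x. Poly_Mapping.lookup u' x \<noteq> Poly_Mapping.lookup v x} \<subset> {x. Poly_Mapping.lookup u x \<noteq> Poly_Mapping.lookup v x}"
        proof (rule psubsetI)
          show "{x. Poly_Mapping.lookup u' x \<noteq> Poly_Mapping.lookup v x} \<subseteq> {x. Poly_Mapping.lookup u x \<noteq> Poly_Mapping.lookup v x}"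
          proof (rule Collect_mono, rule impI)
            fix x assume "Poly_Mapping.lookup u' x \<noteq> Poly_Mapping.lookup v x"
            then show "Poly_Mapping.lookup u x \<noteq> Poly_Mapping.lookup v x"
              using u' vals by (cases "x = i"; cases "x = j") simp_all
          qed
          show "{x. Poly_Mapping.lookup u' x \<noteq> Poly_Mapping.lookup v x} \<noteq> {x. Poly_Mapping.lookup u x \<noteq> Poly_Mapping.lookup v x}"
            using u'(1) vals(1,2) by (auto simp: set_eq_iff intro!: exI[of _ i])
        qed
        then have "card {x. Poly_Mapping.lookup u' x \<noteq> Poly_Mapping.lookup v x} < card {x. Poly_Mapping.lookup u x \<noteq> Poly_Mapping.lookup v x}"
          by (intro psubset_card_mono) auto
        then have "exch_equiv B (add_mset u' M') (add_mset v N)"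
          by (rule less.hyps) (use M' less.prems in auto)
        with M'(1) show ?thesis by (rule exch_equiv.trans)
      next
        case noM: False
        txt \<open>Failing to switch \<^term>\<open>u\<close> at \<^term>\<open>i\<close>, \<^term>\<open>j\<close> inside \<^term>\<open>M\<close> makes column \<^term>\<open>i\<close> heavier than column \<^term>\<open>j\<close>,
          which forces a switch inside \<^term>\<open>N\<close> by comparing column sums.\<close>
        have "\<exists>w\<in>#N. Poly_Mapping.lookup w j = q j \<and> Poly_Mapping.lookup w i = q i + 1"
        proof (rule ccontr)
          assume noN: "\<not> ?thesis"
          \<comment> \<open>Without a suitable row, the excess over \<open>q\<close> in column
            \<open>j\<close> never exceeds that in column \<open>i\<close>, row by row; in
            \<open>N\<close> the comparison is reversed.\<close>
          have "(\<Sum>w\<in>#M. Poly_Mapping.lookup w j + q i) \<le> (\<Sum>w\<in>#M. Poly_Mapping.lookup w i + q j)"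
          proof (rule sum_mset_mono)
            fix w assume w: "w \<in># M"
            then have "q i \<le> Poly_Mapping.lookup w i" "Poly_Mapping.lookup w i \<le> q i + 1"
              "q j \<le> Poly_Mapping.lookup w j" "Poly_Mapping.lookup w j \<le> q j + 1"
              using less.prems(3) by (auto simp: levels_def)
            moreover have "\<not> (Poly_Mapping.lookup w i = q i \<and> Poly_Mapping.lookup w j = q j + 1)" using noM w by blast
            ultimately show "Poly_Mapping.lookup w j + q i \<le> Poly_Mapping.lookup w i + q j" by linarith
          qed
          moreover have "(\<Sum>w\<in>#N. Poly_Mapping.lookup w i + q j) \<le> (\<Sum>w\<in>#N. Poly_Mapping.lookup w j + q i)"
          proof (rule sum_mset_mono)
            fix w assume w: "w \<in># N"
            then have "q i \<le> Poly_Mapping.lookup w i" "Poly_Mapping.lookup w i \<le> q i + 1"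
              "q j \<le> Poly_Mapping.lookup w j" "Poly_Mapping.lookup w j \<le> q j + 1"
              using less.prems(4) by (auto simp: levels_def)
            moreover have "\<not> (Poly_Mapping.lookup w j = q j \<and> Poly_Mapping.lookup w i = q i + 1)" using noN w by blast
            ultimately show "Poly_Mapping.lookup w i + q j \<le> Poly_Mapping.lookup w j + q i" by linarith
          qed
          moreover have "Poly_Mapping.lookup u x + (\<Sum>w\<in>#M. Poly_Mapping.lookup w x) = Poly_Mapping.lookup v x + (\<Sum>w\<in>#N. Poly_Mapping.lookup w x)" for x
            using arg_cong[OF less.prems(5), of "\<lambda>s. Poly_Mapping.lookup s x"] by (simp add: sum_lookup_mset lookup_add)
          \<comment> \<open>The rows \<open>u\<close> and \<open>v\<close> differ by one in each
            column, so \<open>N\<close> has one more unit than \<open>M\<close> in column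
            \<open>i\<close> and one fewer in column \<open>j\<close>. The sum of the two
            inequalities then fails by 2.\<close>
          from this[of i] this[of j] have "(\<Sum>w\<in>#N. Poly_Mapping.lookup w i) = 1 + (\<Sum>w\<in>#M. Poly_Mapping.lookup w i)"
             "(\<Sum>w\<in>#M. Poly_Mapping.lookup w j) = 1 + (\<Sum>w\<in>#N. Poly_Mapping.lookup w j)"
            using vals by auto
          ultimately show False using less.prems(6,7) by (simp add: sum_mset.distrib sum_mset_constant)
        qed
        then obtain w where w: "w \<in># N" "Poly_Mapping.lookup w j = q j" "Poly_Mapping.lookup w i = q i + 1" by blast
        obtain v' N' where N': "exch_equiv B (add_mset v N) (add_mset v' N')" "set_mset (add_mset v' N') \<subseteq> B"
          "levels q (add_mset v' N')" "\<Sum>\<^sub># (add_mset v' N') = \<Sum>\<^sub># (add_mset v N)" "size N' = size N"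
          and v': "Poly_Mapping.lookup v' j = q j" "Poly_Mapping.lookup v' i = q i + 1"
          "\<And>x. x \<noteq> j \<Longrightarrow> x \<noteq> i \<Longrightarrow> Poly_Mapping.lookup v' x = Poly_Mapping.lookup v x"
          using levels_swap[OF B less.prems(2,4) w(1) ij(1)[symmetric] vals(4) w(2) vals(2) w(3)] by blast
        have "{x. Poly_Mapping.lookup u x \<noteq> Poly_Mapping.lookup v' x} \<subset> {x. Poly_Mapping.lookup u x \<noteq> Poly_Mapping.lookup v x}"
        proof (rule psubsetI)
          show "{x. Poly_Mapping.lookup u x \<noteq> Poly_Mapping.lookup v' x} \<subseteq> {x. Poly_Mapping.lookup u x \<noteq> Poly_Mapping.lookup v x}"
          proof (rule Collect_mono, rule impI)
            fix x assume "Poly_Mapping.lookup u x \<noteq> Poly_Mapping.lookup v' x"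
            then show "Poly_Mapping.lookup u x \<noteq> Poly_Mapping.lookup v x"
              using v' vals by (cases "x = i"; cases "x = j") simp_all
          qed
          show "{x. Poly_Mapping.lookup u x \<noteq> Poly_Mapping.lookup v' x} \<noteq> {x. Poly_Mapping.lookup u x \<noteq> Poly_Mapping.lookup v x}"
            using v'(2) vals(1,2) by (auto simp: set_eq_iff intro!: exI[of _ i])
        qed
        then have "card {x. Poly_Mapping.lookup u x \<noteq> Poly_Mapping.lookup v' x} < card {x. Poly_Mapping.lookup u x \<noteq> Poly_Mapping.lookup v x}"
          by (intro psubset_card_mono) auto
        then have "exch_equiv B (add_mset u M) (add_mset v' N')"
          by (rule less.hyps) (use N' less.prems in auto)
        then show ?thesis using N'(1) by (blast intro: exch_equiv.trans exch_equiv.sym)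
      qed
    qed
  qed
  obtain u M1 where M1: "M = add_mset u M1" using Suc.hyps(2) by (metis size_eq_Suc_imp_eq_union)
  obtain v N1 where N1: "N = add_mset v N1" using Suc.hyps(2) Suc.prems(6) by (metis size_eq_Suc_imp_eq_union)
  show ?case unfolding M1 N1
    by (rule first) (use M1 N1 Suc.prems Suc.hyps(2) in auto)
qed

lemma exch_equiv_same_sum:
  assumes B: "strong_exch B \<kappa>" and MN: "set_mset M \<subseteq> B" "set_mset N \<subseteq> B" "\<Sum>\<^sub># M = \<Sum>\<^sub># N"
    and deg: "\<And>u. u \<in> B \<Longrightarrow> wt u UNIV = d" "d > 0"
  shows "exch_equiv B M N"
proof -
  \<comment> \<open>Since \<open>d > 0\<close>, the total degree of the sum determines the number of
    summands.\<close>
  have "wt (\<Sum>\<^sub># L) UNIV = size L * d" if "set_mset L \<subseteq> B" for L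
    using that by (induction L) (auto simp: lookup_add sum.distrib deg)
  from this[OF MN(1)] this[OF MN(2)] have size: "size M = size N" using deg(2) MN(3) by simp
  obtain M' where M': "exch_equiv B M M'" "set_mset M' \<subseteq> B" "\<Sum>\<^sub># M' = \<Sum>\<^sub># M" "size M' = size M"
    "\<And>u v i. u \<in># M' \<Longrightarrow> v \<in># M' \<Longrightarrow> Poly_Mapping.lookup u i \<le> Poly_Mapping.lookup v i + 1"
    using exch_equiv_balanced[OF B MN(1)] by blast
  obtain N' where N': "exch_equiv B N N'" "set_mset N' \<subseteq> B" "\<Sum>\<^sub># N' = \<Sum>\<^sub># N" "size N' = size N"
    "\<And>u v i. u \<in># N' \<Longrightarrow> v \<in># N' \<Longrightarrow> Poly_Mapping.lookup u i \<le> Poly_Mapping.lookup v i + 1"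
    using exch_equiv_balanced[OF B MN(2)] by blast
  define q where "q x = Poly_Mapping.lookup (\<Sum>\<^sub># M) x div size M" for x
  have lev: "levels q L"
    if "\<Sum>\<^sub># L = \<Sum>\<^sub># M" "size L = size M"
      "\<And>u v i. u \<in># L \<Longrightarrow> v \<in># L \<Longrightarrow> Poly_Mapping.lookup u i \<le> Poly_Mapping.lookup v i + 1" for L
    unfolding levels_def
  proof (intro ballI allI)
    fix w x assume w: "w \<in># L"
    from balanced_between[where f = "\<lambda>w. Poly_Mapping.lookup w x", OF w that(3)]
    show "q x \<le> Poly_Mapping.lookup w x \<and> Poly_Mapping.lookup w x \<le> q x + 1"
      unfolding q_def that(1)[symmetric] that(2)[symmetric] sum_lookup_mset by simp
  qed
  have "exch_equiv B M' N'"
    by (rule exch_equiv_levels[OF B M'(2) N'(2) lev[OF M'(3,4,5)] lev])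
      (use M' N' MN size in auto)
  then show ?thesis using M'(1) N'(1) by (blast intro: exch_equiv.trans exch_equiv.sym)
qed

section \<open>Maximum bounded matchings\<close>

definition deg :: "'v set multiset \<Rightarrow> 'v \<Rightarrow> nat" where
  "deg H x = size {#e \<in># H. x \<in> e#}"

definition b_matching :: "'v set set \<Rightarrow> ('v \<Rightarrow> nat) \<Rightarrow> 'v set multiset \<Rightarrow> bool" where
  "b_matching E c H \<longleftrightarrow> set_mset H \<subseteq> E \<and> (\<forall>x. deg H x \<le> c x)"

definition max_b_matching :: "'v set set \<Rightarrow> ('v \<Rightarrow> nat) \<Rightarrow> 'v set multiset \<Rightarrow> bool" where
  "max_b_matching E c H \<longleftrightarrow> b_matching E c H \<and> (\<forall>H'. b_matching E c H' \<longrightarrow> size H' \<le> size H)"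

lemma deg_simps [simp]:
  "deg {#} x = 0"
  "deg (add_mset e H) x = of_bool (x \<in> e) + deg H x"
  "deg (H + H') x = deg H x + deg H' x"
  by (simp_all add: deg_def)

lemma deg_diff: "K \<subseteq># H \<Longrightarrow> deg (H - K) x + deg K x = deg H x"
  by (auto simp: mset_subset_eq_exists_conv)

lemma deg_pos_iff: "deg H x > 0 \<longleftrightarrow> (\<exists>e\<in>#H. x \<in> e)"
  by (induction H) auto

lemma sum_deg: "finite S \<Longrightarrow> (\<Sum>x\<in>S. deg H x) = (\<Sum>e\<in>#H. card (e \<inter> S))"
proof (induction H)
  case (add e H)
  have "(\<Sum>x\<in>S. of_bool (x \<in> e)) = card (e \<inter> S)"
    using add.prems by (simp add: sum_of_bool_eq) (metis Int_commute)
  with add show ?case by (simp add: sum.distrib)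
qed simp

text \<open>The common tool for all reroutings. With \<open>L\<close> one edge longer than
  \<open>K\<close>, the first conclusion excludes an augmentation; with equal sizes, the second
  builds a new maximum b-matching. Degrees are compared additively to avoid truncated
  subtraction.\<close>

lemma max_b_matching_replace:
  assumes "max_b_matching E c H" "K \<subseteq># H" "set_mset L \<subseteq> E"
    and le: "\<And>x. deg H x + deg L x \<le> c x + deg K x"
  shows "size L \<le> size K" "size L = size K \<Longrightarrow> max_b_matching E c (H - K + L)"
    "deg (H - K + L) x + deg K x = deg H x + deg L x"
proof -
  have d: "deg (H - K + L) x + deg K x = deg H x + deg L x" for x
    using deg_diff[OF assms(2), of x] by simp
  have "deg (H - K + L) x \<le> c x" for x using d[of x] le[of x] by simp
  moreover have "set_mset (H - K + L) \<subseteq> E"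
    using assms(1,3) by (auto simp: max_b_matching_def b_matching_def dest: in_diffD)
  ultimately have b: "b_matching E c (H - K + L)" by (simp add: b_matching_def)
  have sz: "size (H - K + L) + size K = size H + size L"
    using assms(2) by (auto simp: mset_subset_eq_exists_conv)
  have "size (H - K + L) \<le> size H" using assms(1) b unfolding max_b_matching_def by blast
  then show "size L \<le> size K" using sz by linarith
  show "max_b_matching E c (H - K + L)" if "size L = size K"
  proof -
    have "size (H - K + L) = size H" using sz that by simp
    then show ?thesis using b assms(1) unfolding max_b_matching_def by presburger
  qed
  show "deg (H - K + L) x + deg K x = deg H x + deg L x" by (rule d)
qed

lemma pair_subset_mset:
  assumes "a \<in># H" "b \<in># H" "a \<noteq> b"
  shows "{#a, b#} \<subseteq># H"
proof -
  obtain H1 where "H = add_mset a H1" using assms(1) by (metis mset_add)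
  then show ?thesis using assms by simp
qed

text \<open>Two units of unused capacity, at \<^term>\<open>p\<close> and at \<^term>\<open>q\<close> (both at the same vertex if \<^term>\<open>p = q\<close>).\<close>

definition spare :: "('v \<Rightarrow> nat) \<Rightarrow> 'v set multiset \<Rightarrow> 'v \<Rightarrow> 'v \<Rightarrow> bool" where
  "spare c H p q \<longleftrightarrow> (\<forall>z. deg H z + of_bool (z = p) + of_bool (z = q) \<le> c z)"

lemma spare_distinct:
  assumes "p \<noteq> q" "deg H p < c p" "deg H q < c q" "\<And>z. deg H z \<le> c z"
  shows "spare c H p q"
  unfolding spare_def
proof
  fix z show "deg H z + of_bool (z = p) + of_bool (z = q) \<le> c z"
    using assms(1-3) assms(4)[of z] by (cases "z = p"; cases "z = q") auto
qed

lemma spare_same: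
  assumes "deg H p + 2 \<le> c p" "\<And>z. deg H z \<le> c z"
  shows "spare c H p p"
  unfolding spare_def
proof
  fix z show "deg H z + of_bool (z = p) + of_bool (z = p) \<le> c z"
    using assms(1) assms(2)[of z] by (cases "z = p") auto
qed

lemma spareD:
  assumes "spare c H p q"
  shows "deg H p < c p" "deg H q < c q"
  using assms[unfolded spare_def, rule_format, of p] assms[unfolded spare_def, rule_format, of q] by auto

text \<open>The shape K - M on \<open>C\<close>, with the parts encoded as fibres of
  \<open>part\<close>. The last assumption is the matching property in the form in which it is used:
  a vertex has at most one partner in \<open>M\<close>.\<close>

locale component_structure =
  fixes E :: "'v::finite set set" and C :: "'v set" and part :: "'v \<Rightarrow> 'b" and M :: "'v set set"
  assumes edge_card: "e \<in> E \<Longrightarrow> card e = 2"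
    and closed: "e \<in> E \<Longrightarrow> e \<inter> C \<noteq> {} \<Longrightarrow> e \<subseteq> C"
    and adj: "x \<in> C \<Longrightarrow> y \<in> C \<Longrightarrow> {x, y} \<in> E \<longleftrightarrow> part x \<noteq> part y \<and> {x, y} \<notin> M"
    and M_part: "x \<in> C \<Longrightarrow> y \<in> C \<Longrightarrow> {x, y} \<in> M \<Longrightarrow> part x \<noteq> part y"
    and M_unique: "{x, y} \<in> M \<Longrightarrow> {x, z} \<in> M \<Longrightarrow> y = z"
begin

text \<open>An edge is not a loop, so its incidence splits into one term per endpoint; degree
  conditions on reroutings then become linear identities.\<close>

lemma edge_ind: "{x, y} \<in> E \<Longrightarrow> (of_bool (z \<in> {x, y}) :: nat) = of_bool (z = x) + of_bool (z = y)"
  using edge_card[of "{x, y}"] by (auto simp: of_bool_def)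

lemma edge_obtain:
  assumes "e \<in> E" "e \<subseteq> C"
  obtains x y where "e = {x, y}" "x \<noteq> y" "x \<in> C" "y \<in> C"
  using edge_card[OF assms(1)] assms(2) by (auto simp: card_2_iff)

lemma deg_edge_simps [simp]:
  assumes "{x, y} \<in> E"
  shows "deg (add_mset {x, y} H) z = of_bool (z = x) + of_bool (z = y) + deg H z"
  unfolding deg_simps edge_ind[OF assms] ..

section \<open>Short augmenting walks\<close>

lemma no_augment_edge:
  assumes "max_b_matching E c H" "spare c H p q"
  shows "{p, q} \<notin> E"
proof
  assume pq: "{p, q} \<in> E"
  have "size {#{p, q}#} \<le> size ({#} :: 'v set multiset)"
  proof (rule max_b_matching_replace(1)[OF assms(1)])
    fix x show "deg H x + deg {#{p, q}#} x \<le> c x + deg {#} x"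
      using assms(2)[unfolded spare_def, rule_format, of x] pq by (simp del: deg_simps(2))
  qed (use pq in auto)
  then show False by simp
qed

text \<open>The augmenting walk is \<open>p\<close>, \<open>x\<close>, \<open>y\<close>,
  \<open>q\<close>. It may be closed: for \<open>p = q\<close> it consumes two units at
  \<open>p\<close>.\<close>

lemma no_augment_path:
  assumes "max_b_matching E c H" "spare c H p q" "{x, y} \<in># H" "{p, x} \<in> E" "{q, y} \<in> E"
  shows False
proof -
  have xy: "{x, y} \<in> E" using assms by (auto simp: max_b_matching_def b_matching_def)
  have "size {#{p, x}, {q, y}#} \<le> size {#{x, y}#}"
  proof (rule max_b_matching_replace(1)[OF assms(1)])
    fix z show "deg H z + deg {#{p, x}, {q, y}#} z \<le> c z + deg {#{x, y}#} z"
      using assms(2)[unfolded spare_def, rule_format, of z] assms(4,5) xy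
      by (simp del: deg_simps(2))
  qed (use assms in auto)
  then show False by simp
qed

text \<open>The closed augmenting walk is \<open>s\<close>, \<open>m\<close>, \<open>t\<close>,
  \<open>k\<close>, \<open>l\<close>, \<open>s\<close>. It adds three edges, removes two, and uses
  both spare units at \<open>s\<close>.\<close>

lemma no_augment_double:
  assumes "max_b_matching E c H" "spare c H s s" "{t, m} \<in># H" "{k, l} \<in># H" "{t, m} \<noteq> {k, l}"
    "{k, t} \<in> E" "{l, s} \<in> E" "{m, s} \<in> E"
  shows False
proof -
  have e: "{t, m} \<in> E" "{k, l} \<in> E" using assms by (auto simp: max_b_matching_def b_matching_def)
  have "size {#{k, t}, {l, s}, {m, s}#} \<le> size {#{t, m}, {k, l}#}"
  proof (rule max_b_matching_replace(1)[OF assms(1)])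
    fix z show "deg H z + deg {#{k, t}, {l, s}, {m, s}#} z \<le> c z + deg {#{t, m}, {k, l}#} z"
      using assms(2)[unfolded spare_def, rule_format, of z] assms(6-) e
      by (simp del: deg_simps(2))
    show "{#{t, m}, {k, l}#} \<subseteq># H"
      by (rule pair_subset_mset[OF assms(3-5)])
  qed (use assms in auto)
  then show False by simp
qed

text \<open>\<^term>\<open>S\<close> certifies optimality of \<^term>\<open>H\<close> in the component: as \<^term>\<open>S\<close> is stable and \<^term>\<open>C - S\<close> is saturated
  and matched into \<^term>\<open>S\<close>, every maximum \<^term>\<open>b_matching E c\<close> has the same structure. In the proof
  \<^term>\<open>S\<close> is either a part of the multipartite graph or an edge of \<^term>\<open>M\<close>.\<close>

definition certificate :: "('v \<Rightarrow> nat) \<Rightarrow> 'v set multiset \<Rightarrow> 'v set \<Rightarrow> bool" where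
  "certificate c H S \<longleftrightarrow> S \<subseteq> C \<and>
     (\<forall>e\<in>#H. e \<subseteq> C \<longrightarrow> (\<exists>x\<in>S. \<exists>y\<in>C - S. e = {x, y})) \<and>
     (\<forall>x\<in>S. \<forall>y\<in>S. {x, y} \<notin> E) \<and>
     (\<forall>y\<in>C - S. deg H y = c y) \<and>
     (\<forall>i\<in>S. \<forall>j\<in>S. \<forall>m\<in>S. \<forall>k\<in>C - S. i \<noteq> j \<longrightarrow> j \<noteq> m \<longrightarrow> i \<noteq> m \<longrightarrow> {j, k} \<notin> E \<longrightarrow> {m, k} \<in> E)"

lemma edge_C: "e \<in># H \<Longrightarrow> max_b_matching E c H \<Longrightarrow> e \<in> E"
  by (auto simp: max_b_matching_def b_matching_def)

lemma M_unique': "{x, z} \<in> M \<Longrightarrow> {y, z} \<in> M \<Longrightarrow> x = y"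
  using M_unique by (metis insert_commute)

lemma adj_same: "x \<in> C \<Longrightarrow> y \<in> C \<Longrightarrow> part x = part y \<Longrightarrow> {x, y} \<notin> E"
  by (simp add: adj)

text \<open>The pair is stable because its edge was deleted from K. The last clause of
  \<open>certificate\<close> is vacuous here, as it speaks of three distinct vertices of
  \<open>S\<close>.\<close>

lemma certificate_pair:
  assumes H: "max_b_matching E c H" and pq: "p \<in> C" "q \<in> C" "{p, q} \<in> M"
    and meets: "\<And>x y. {x, y} \<in># H \<Longrightarrow> x \<in> C \<Longrightarrow> y \<in> C \<Longrightarrow> x \<notin> {p, q} \<Longrightarrow> y \<notin> {p, q} \<Longrightarrow> False"
    and sat: "\<And>y. y \<in> C \<Longrightarrow> y \<notin> {p, q} \<Longrightarrow> deg H y = c y"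
  shows "certificate c H {p, q}"
proof -
  have stable: "\<forall>x\<in>{p, q}. \<forall>y\<in>{p, q}. {x, y} \<notin> E"
    using pq adj_same[of p p] adj_same[of q q] adj[of p q] by (auto simp: insert_commute)
  have "\<exists>x\<in>{p, q}. \<exists>y\<in>C - {p, q}. e = {x, y}" if e: "e \<in># H" "e \<subseteq> C" for e
  proof -
    obtain x y where xy: "e = {x, y}" "x \<in> C" "y \<in> C"
      using edge_obtain[OF edge_C[OF e(1) H] e(2)] by metis
    have "{x, y} \<in> E" using edge_C[OF e(1) H] xy by simp
    then have "\<not> (x \<in> {p, q} \<and> y \<in> {p, q})" using stable by blast
    moreover have "x \<in> {p, q} \<or> y \<in> {p, q}" using meets[of x y] e xy by blast
    ultimately show ?thesis using xy by (metis Diff_iff insert_commute)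
  qed
  then show ?thesis unfolding certificate_def using pq stable sat by auto
qed

lemma certificate_part:
  assumes H: "max_b_matching E c H"
    and meets: "\<And>x y. {x, y} \<in># H \<Longrightarrow> x \<in> C \<Longrightarrow> y \<in> C \<Longrightarrow> part x \<noteq> a \<Longrightarrow> part y \<noteq> a \<Longrightarrow> False"
    and sat: "\<And>y. y \<in> C \<Longrightarrow> part y \<noteq> a \<Longrightarrow> deg H y = c y"
  shows "certificate c H {x \<in> C. part x = a}" (is "certificate c H ?S")
proof -
  have "\<exists>x\<in>?S. \<exists>y\<in>C - ?S. e = {x, y}" if e: "e \<in># H" "e \<subseteq> C" for e
  proof -
    obtain x y where xy: "e = {x, y}" "x \<in> C" "y \<in> C"
      using edge_obtain[OF edge_C[OF e(1) H] e(2)] by metis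
    have "{x, y} \<in> E" using edge_C[OF e(1) H] xy by simp
    then have "part x \<noteq> part y" using xy adj by blast
    moreover have "part x = a \<or> part y = a" using meets[of x y] e xy by blast
    ultimately have "x \<in> ?S \<and> y \<in> C - ?S \<or> y \<in> ?S \<and> x \<in> C - ?S" using xy by auto
    then show ?thesis using xy(1) insert_commute[of x y "{}"] by blast
  qed
  \<comment> \<open>Outside its own part, \<open>k\<close> misses only its partner in
    \<open>M\<close>, so it cannot miss both \<open>j\<close> and \<open>m\<close>.\<close>
  moreover have "{m, k} \<in> E" if "j \<in> ?S" "m \<in> ?S" "k \<in> C - ?S" "j \<noteq> m" "{j, k} \<notin> E" for j m k
  proof (rule ccontr)
    assume "{m, k} \<notin> E"
    with that have "{m, k} \<in> M" "{j, k} \<in> M" by (auto simp: adj)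
    with M_unique' that(4) show False by blast
  qed
  moreover have "\<forall>x\<in>?S. \<forall>y\<in>?S. {x, y} \<notin> E" by (auto simp: adj)
  moreover have "\<forall>y\<in>C - ?S. deg H y = c y" using sat by blast
  ultimately show ?thesis unfolding certificate_def by blast
qed

text \<open>Vertices with a spare pair of units are nonadjacent. If they are distinct, they are
  either partners in \<open>M\<close> or in one part, and this pair or part is \<open>S\<close>. If
  all the slack sits at one vertex \<open>p\<close>, then \<open>S\<close> is the part of
  \<open>p\<close>, unless an edge of \<open>H\<close> avoids that part; in this case
  \<open>S\<close> consists of \<open>p\<close> and its partner.\<close>

lemma certificate_exists:
  assumes H: "max_b_matching E c H" and pq: "p \<in> C" "q \<in> C" "spare c H p q"
  obtains S where "certificate c H S"
proof -
  have le: "deg H x \<le> c x" for x using H by (simp add: max_b_matching_def b_matching_def)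
  have matched: "\<exists>S. certificate c H S" if p: "p \<in> C" "q \<in> C" "spare c H p q" "{p, q} \<in> M" for p q
  proof -
    have ne: "part p \<noteq> part q" "p \<noteq> q" using M_part p by auto
    have adj_p: "{p, z} \<in> E \<longleftrightarrow> part z \<noteq> part p" if "z \<in> C" "z \<noteq> q" for z
      using adj[OF p(1) that(1)] M_unique[OF p(4), of z] that(2) by auto
    have adj_q: "{q, z} \<in> E \<longleftrightarrow> part z \<noteq> part q" if "z \<in> C" "z \<noteq> p" for z
      using adj[OF p(2) that(1)] M_unique[of q p z] p(4) that(2) by (auto simp: insert_commute)
    have "certificate c H {p, q}"
    proof (rule certificate_pair[OF H p(1,2,4)])
      fix x y assume xy: "{x, y} \<in># H" "x \<in> C" "y \<in> C" "x \<notin> {p, q}" "y \<notin> {p, q}"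
      have xyE: "part x \<noteq> part y" using edge_C[OF xy(1) H] adj xy by blast
      \<comment> \<open>Both orientations of the edge are blocked. Away from each other,
        \<open>p\<close> and \<open>q\<close> miss only their own parts, so this would put
        \<open>x\<close> and \<open>y\<close> into one part.\<close>
      have "{p, x} \<notin> E \<or> {q, y} \<notin> E" using no_augment_path[OF H p(3) xy(1)] by blast
      moreover have "{p, y} \<notin> E \<or> {q, x} \<notin> E"
        using no_augment_path[OF H p(3), of y x] xy(1) by (auto simp: insert_commute)
      ultimately show False
        using adj_p[OF xy(2)] adj_p[OF xy(3)] adj_q[OF xy(2)] adj_q[OF xy(3)] xy(4,5) ne xyE by auto
    next
      fix z assume z: "z \<in> C" "z \<notin> {p, q}"
      show "deg H z = c z"
      proof (rule ccontr)
        assume "deg H z \<noteq> c z"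
        with le[of z] have "deg H z < c z" by simp
        have "p \<noteq> z" "q \<noteq> z" using z(2) by auto
        then have "spare c H p z" "spare c H q z"
          using spare_distinct[OF _ _ \<open>deg H z < c z\<close> le] spareD[OF p(3)] by simp_all
        then have "{p, z} \<notin> E" "{q, z} \<notin> E" using no_augment_edge[OF H] by blast+
        then show False using adj_p[OF z(1)] adj_q[OF z(1)] z(2) ne by simp
      qed
    qed
    then show ?thesis by blast
  qed
  have unmatched: "\<exists>S. certificate c H S" if p: "p \<in> C" "q \<in> C" "spare c H p q" "p \<noteq> q" "{p, q} \<notin> M" for p q
  proof -
    have same: "part q = part p" using no_augment_edge[OF H p(3)] adj p by auto
    have adj_p: "{p, z} \<in> E \<longleftrightarrow> {p, z} \<notin> M" if "z \<in> C" "part z \<noteq> part p" for z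
      using adj[OF p(1) that(1)] that(2) by auto
    have adj_q: "{q, z} \<in> E \<longleftrightarrow> {q, z} \<notin> M" if "z \<in> C" "part z \<noteq> part p" for z
      using adj[OF p(2) that(1)] that(2) same by auto
    have "certificate c H {x \<in> C. part x = part p}"
    proof (rule certificate_part[OF H])
      fix x y assume xy: "{x, y} \<in># H" "x \<in> C" "y \<in> C" "part x \<noteq> part p" "part y \<noteq> part p"
      have "x \<noteq> y" using edge_C[OF xy(1) H] edge_card[of "{x, y}"] by auto
      \<comment> \<open>Now only \<open>M\<close> can block a path. Blocking both orientations gives
        some vertex two partners.\<close>
      have "{p, x} \<in> M \<or> {q, y} \<in> M" using no_augment_path[OF H p(3) xy(1)] adj_p adj_q xy by blast
      moreover have "{p, y} \<in> M \<or> {q, x} \<in> M"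
        using no_augment_path[OF H p(3), of y x] xy adj_p adj_q by (auto simp: insert_commute)
      ultimately show False using M_unique M_unique' \<open>x \<noteq> y\<close> p(4) by blast
    next
      fix z assume z: "z \<in> C" "part z \<noteq> part p"
      show "deg H z = c z"
      proof (rule ccontr)
        assume "deg H z \<noteq> c z"
        with le[of z] have "deg H z < c z" by simp
        have "p \<noteq> z" "q \<noteq> z" using z(2) same by metis+
        then have "spare c H p z" "spare c H q z"
          using spare_distinct[OF _ _ \<open>deg H z < c z\<close> le] spareD[OF p(3)] by simp_all
        with no_augment_edge[OF H] have "{p, z} \<notin> E" "{q, z} \<notin> E" by auto
        with adj_p[OF z] adj_q[OF z] M_unique' p(4) show False by blast
      qed
    qed
    then show ?thesis by blast
  qed
  have "\<exists>S. certificate c H S"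
  proof (cases "\<exists>p\<in>C. \<exists>q\<in>C. p \<noteq> q \<and> spare c H p q")
    case True
    then show ?thesis using matched unmatched by blast
  next
    case False
    have no: "\<not> spare c H x y" if "x \<in> C" "y \<in> C" "x \<noteq> y" for x y
      using False that by fast
    have "q = p" using no[OF pq(1,2)] pq(3) by argo
    then have s: "spare c H p p" using pq(3) by simp
    have sat: "deg H z = c z" if "z \<in> C" "z \<noteq> p" for z
    proof (rule ccontr)
      assume "deg H z \<noteq> c z"
      with le[of z] have "deg H z < c z" by simp
      with no[OF pq(1) that(1) that(2)[symmetric]] spare_distinct[OF that(2)[symmetric] spareD(1)[OF s] _ le]
      show False by argo
    qed
    have adj_p: "{p, z} \<in> E \<longleftrightarrow> {p, z} \<notin> M" if "z \<in> C" "part z \<noteq> part p" for z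
      using adj[OF pq(1) that(1)] that(2) by auto
    show ?thesis
    proof (cases "\<exists>x\<in>C. \<exists>y\<in>C. {x, y} \<in># H \<and> part x \<noteq> part p \<and> part y \<noteq> part p")
      case False
      have "certificate c H {x \<in> C. part x = part p}"
      proof (rule certificate_part[OF H])
        show "deg H y = c y" if "y \<in> C" "part y \<noteq> part p" for y
          using sat[OF that(1)] that(2) by metis
        show False if "{x, y} \<in># H" "x \<in> C" "y \<in> C" "part x \<noteq> part p" "part y \<noteq> part p" for x y
          using False that by blast
      qed
      then show ?thesis by blast
    next
      case True
      then obtain x y where xy: "x \<in> C" "y \<in> C" "{x, y} \<in># H" "part x \<noteq> part p" "part y \<noteq> part p" by blast
      \<comment> \<open>Otherwise \<open>p\<close>, \<open>x\<close>, \<open>y\<close>,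
        \<open>p\<close> is augmenting. Hence one end of this edge is the partner \<open>t\<close>
        of \<open>p\<close>.\<close>
      have "{p, x} \<in> M \<or> {p, y} \<in> M" using no_augment_path[OF H s xy(3)] adj_p xy by blast
      moreover have "{y, x} \<in># H" using xy(3) by (simp add: insert_commute)
      ultimately obtain t m where tm: "t \<in> C" "m \<in> C" "{t, m} \<in># H" "part t \<noteq> part p" "part m \<noteq> part p" "{p, t} \<in> M"
        using xy by blast
      have "t \<noteq> m" using edge_C[OF tm(3) H] edge_card[of "{t, m}"] by auto
      have adj_t: "{p, z} \<in> E" if "z \<in> C" "part z \<noteq> part p" "z \<noteq> t" for z
        using adj_p[OF that(1,2)] M_unique[OF tm(6), of z] that(3) by auto
      have mp: "{m, p} \<in> E" using adj_t[OF tm(2,5)] \<open>t \<noteq> m\<close> by (auto simp: insert_commute)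
      \<comment> \<open>The partner of \<open>t\<close> is \<open>p\<close>, so \<open>t\<close> is
        adjacent to every other vertex \<open>k\<close> in the part of \<open>p\<close>. This closes
        the walk \<open>p\<close>, \<open>m\<close>, \<open>t\<close>, \<open>k\<close>,
        \<open>l\<close>, \<open>p\<close>.\<close>
      have one: False if kl: "{k, l} \<in># H" "k \<in> C" "l \<in> C" "k \<notin> {p, t}" "l \<notin> {p, t}" "part k = part p" for k l
      proof (rule no_augment_double[OF H s tm(3) kl(1)])
        have "{k, l} \<in> E" using edge_C[OF kl(1) H] .
        then have "part l \<noteq> part p" using adj_same[OF kl(2,3)] kl(6) by auto
        then show "{l, p} \<in> E" using adj_t[of l] kl by (auto simp: insert_commute)
        show "{t, m} \<noteq> {k, l}" using kl by auto
        have "{k, t} \<notin> M" using M_unique'[OF tm(6), of k] kl(4) by auto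
        then show "{k, t} \<in> E" using adj[OF kl(2) tm(1)] tm(4) kl(6) by auto
        show "{m, p} \<in> E" by (rule mp)
      qed
      have "certificate c H {p, t}"
      proof (rule certificate_pair[OF H pq(1) tm(1,6)])
        fix k l assume kl: "{k, l} \<in># H" "k \<in> C" "l \<in> C" "k \<notin> {p, t}" "l \<notin> {p, t}"
        have "part k \<noteq> part p" "part l \<noteq> part p"
          using one[OF kl] one[of l k] kl by (auto simp: insert_commute)
        then have "{p, k} \<in> E" "{p, l} \<in> E" using adj_t kl by auto
        then show False using no_augment_path[OF H s kl(1)] by blast
      qed (use sat in auto)
      then show ?thesis by blast
    qed
  qed
  then show thesis using that by blast
qed

section \<open>Restricting maximum b-matchings to a component\<close>

lemma edge_inter: "e \<in> E \<Longrightarrow> card (e \<inter> C) = 2 * of_bool (e \<subseteq> C)"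
  using closed[of e] edge_card[of e] by (auto simp: Int_absorb2 of_bool_def)

lemma sum_deg_component:
  assumes "set_mset H \<subseteq> E"
  shows "(\<Sum>x\<in>C. deg H x) = 2 * size {#e \<in># H. e \<subseteq> C#}"
proof -
  have "(\<Sum>x\<in>C. deg H x) = (\<Sum>e\<in>#H. 2 * of_bool (e \<subseteq> C))"
    unfolding sum_deg[OF finite]
    by (rule arg_cong[of _ _ sum_mset], rule image_mset_cong, rule edge_inter) (use assms in blast)
  also have "\<dots> = 2 * size {#e \<in># H. e \<subseteq> C#}" by (induction H) auto
  finally show ?thesis .
qed

definition graft :: "'v set multiset \<Rightarrow> 'v set multiset \<Rightarrow> 'v set multiset" where
  "graft H H' = {#e \<in># H. \<not> e \<subseteq> C#} + {#e \<in># H'. e \<subseteq> C#}"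

lemma deg_graft:
  assumes "set_mset H \<subseteq> E" "set_mset H' \<subseteq> E"
  shows "deg (graft H H') x = (if x \<in> C then deg H' x else deg H x)"
proof -
  have "deg {#e \<in># H. \<not> e \<subseteq> C#} x = (if x \<in> C then 0 else deg H x)"
    using assms(1)
  proof (induction H)
    case (add e H)
    then show ?case using closed[of e] by auto
  qed simp
  moreover have "deg {#e \<in># H'. e \<subseteq> C#} x = (if x \<in> C then deg H' x else 0)"
    using assms(2)
  proof (induction H')
    case (add e H)
    then show ?case using closed[of e] by auto
  qed simp
  ultimately show ?thesis by (simp add: graft_def)
qed

text \<open>A b-matching with more edges inside \<open>C\<close> could be grafted into the other one
  and enlarge it, since no edge leaves \<open>C\<close>.\<close>

lemma size_component_eq:
  assumes "max_b_matching E c H" "max_b_matching E c H'"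
  shows "size {#e \<in># H'. e \<subseteq> C#} = size {#e \<in># H. e \<subseteq> C#}"
proof -
  have *: "size {#e \<in># H'. e \<subseteq> C#} \<le> size {#e \<in># H. e \<subseteq> C#}"
    if H: "max_b_matching E c H" "max_b_matching E c H'" for H H'
  proof -
    have E: "set_mset H \<subseteq> E" "set_mset H' \<subseteq> E" using H by (auto simp: max_b_matching_def b_matching_def)
    have "b_matching E c (graft H H')"
      unfolding b_matching_def using H deg_graft[OF E] E
      by (auto simp: max_b_matching_def b_matching_def graft_def)
    then have "size (graft H H') \<le> size H" using H(1) unfolding max_b_matching_def by blast
    moreover have "size H = size {#e \<in># H. \<not> e \<subseteq> C#} + size {#e \<in># H. e \<subseteq> C#}"
      by (metis add.commute multiset_partition size_union)
    ultimately show ?thesis by (simp add: graft_def)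
  qed
  show ?thesis using *[OF assms] *[OF assms(2,1)] by simp
qed

lemma sum_deg_eq:
  assumes "max_b_matching E c H" "max_b_matching E c H'"
  shows "(\<Sum>x\<in>C. deg H x) = (\<Sum>x\<in>C. deg H' x)"
  using size_component_eq[OF assms] sum_deg_component assms by (simp add: max_b_matching_def b_matching_def)

lemma max_graft:
  assumes H: "max_b_matching E c H" "max_b_matching E c H'"
  shows "max_b_matching E c (graft H H')"
proof -
  have E: "set_mset H \<subseteq> E" "set_mset H' \<subseteq> E" using H by (auto simp: max_b_matching_def b_matching_def)
  have "b_matching E c (graft H H')"
    unfolding b_matching_def using H deg_graft[OF E] E
    by (auto simp: max_b_matching_def b_matching_def graft_def)
  moreover have "size H = size {#e \<in># H. \<not> e \<subseteq> C#} + size {#e \<in># H. e \<subseteq> C#}"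
    by (metis add.commute multiset_partition size_union)
  then have "size (graft H H') = size H" using size_component_eq[OF H] by (simp add: graft_def)
  ultimately show ?thesis using H(1) by (simp add: max_b_matching_def)
qed

section \<open>The exchange inside a component\<close>

lemma certificate_exchange:
  assumes H: "max_b_matching E c H" "max_b_matching E c H'" and S: "certificate c H S"
    and ij: "i \<in> C" "j \<in> C" "deg H i > deg H' i" "deg H j < deg H' j"
  shows "\<exists>H''. max_b_matching E c H'' \<and> (\<forall>x. deg H'' x + of_bool (x = i) = deg H x + of_bool (x = j))"
proof -
  have le: "deg H x \<le> c x" "deg H' x \<le> c x" for x using H by (simp_all add: max_b_matching_def b_matching_def)
  have E: "e \<in> E" if "e \<in># H \<or> e \<in># H'" for e using H edge_C that by blast
  define T where "T = C - S"
  have SC: "S \<subseteq> C" and stable: "\<And>x y. x \<in> S \<Longrightarrow> y \<in> S \<Longrightarrow> {x, y} \<notin> E"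
    and sat: "\<And>y. y \<in> T \<Longrightarrow> deg H y = c y"
    and cross: "\<And>e. e \<in># H \<Longrightarrow> e \<subseteq> C \<Longrightarrow> \<exists>x\<in>S. \<exists>y\<in>T. e = {x, y}"
    using S by (auto simp: certificate_def T_def)
  have far: "{m, k} \<in> E" if "i \<in> S" "j \<in> S" "m \<in> S" "k \<in> T" "i \<noteq> j" "j \<noteq> m" "i \<noteq> m" "{j, k} \<notin> E" for m k
    using S that unfolding certificate_def T_def by blast
  have TC: "T \<subseteq> C" "S \<inter> T = {}" "S \<union> T = C" using SC by (auto simp: T_def)
  have "i \<noteq> j" using ij by auto
  \<comment> \<open>Stability of \<open>S\<close> sends the other end of every edge of
    \<open>H'\<close> at \<open>S\<close> into \<open>T\<close>. For \<open>H\<close>, all of whose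
    edges in \<open>C\<close> cross, equality holds.\<close>
  have sum_le: "(\<Sum>x\<in>S. deg H' x) \<le> (\<Sum>x\<in>T. deg H' x)"
    unfolding sum_deg[OF finite]
  proof (rule sum_mset_mono)
    fix e assume "e \<in># H'"
    then have e: "e \<in> E" using E by blast
    show "card (e \<inter> S) \<le> card (e \<inter> T)"
    proof (cases "e \<subseteq> C")
      case True
      obtain x y where xy: "e = {x, y}" "x \<noteq> y" "x \<in> C" "y \<in> C" using edge_obtain[OF e True] by metis
      have "\<not> (x \<in> S \<and> y \<in> S)" using stable e xy by blast
      then show ?thesis using xy TC(2,3) by (cases "x \<in> S"; cases "y \<in> S") (auto simp: Int_insert_left)
    next
      case False
      then have "e \<inter> S = {}" using closed[OF e] SC by blast
      then show ?thesis by simp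
    qed
  qed
  have sum_eq: "(\<Sum>x\<in>S. deg H x) = (\<Sum>x\<in>T. deg H x)"
    unfolding sum_deg[OF finite]
  proof (rule arg_cong[of _ _ sum_mset], rule image_mset_cong)
    fix e assume eH: "e \<in># H"
    then have e: "e \<in> E" using E by blast
    show "card (e \<inter> S) = card (e \<inter> T)"
    proof (cases "e \<subseteq> C")
      case True
      then obtain x y where xy: "x \<in> S" "y \<in> T" "e = {x, y}" using cross[OF eH] by blast
      then have "e \<inter> S = {x}" "e \<inter> T = {y}" using TC(2) by auto
      then show ?thesis by simp
    next
      case False
      then have "e \<inter> C = {}" using closed[OF e] by blast
      then have "e \<inter> S = {}" "e \<inter> T = {}" using SC TC(1) by auto
      then show ?thesis by simp
    qed
  qed
  have split: "(\<Sum>x\<in>C. deg K x) = (\<Sum>x\<in>S. deg K x) + (\<Sum>x\<in>T. deg K x)" for K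
    unfolding TC(3)[symmetric] by (rule sum.union_disjoint) (use TC(2) in auto)
  have T_le: "(\<Sum>x\<in>T. deg H' x) \<le> (\<Sum>x\<in>T. deg H x)"
    by (rule sum_mono) (use sat le in simp)
  \<comment> \<open>Both matchings have the same total degree on \<open>C\<close>, and
    \<open>H\<close> puts exactly half of it on \<open>T\<close>. At least half of that of
    \<open>H'\<close> lies on \<open>T\<close>, but no more than for \<open>H\<close>.\<close>
  have T_eq: "(\<Sum>x\<in>T. deg H' x) = (\<Sum>x\<in>T. deg H x)"
    using split[of H] split[of H'] sum_deg_eq[OF H] sum_eq sum_le T_le by linarith
  have sat': "deg H' y = c y" if "y \<in> T" for y
  proof (rule ccontr)
    assume "deg H' y \<noteq> c y"
    then have "deg H' y < deg H y" using le(2)[of y] sat[OF that] by simp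
    then have "(\<Sum>x\<in>T. deg H' x) < (\<Sum>x\<in>T. deg H x)"
      using that sat le by (intro sum_strict_mono_ex1) auto
    with T_eq show False by simp
  qed
  have "i \<notin> T" using sat' le(1)[of i] ij(3) by force
  moreover have "j \<notin> T" using sat le(2)[of j] ij(4) by force
  ultimately have ijS: "i \<in> S" "j \<in> S" using ij(1,2) by (auto simp: T_def)
  define N where "N = {k. {j, k} \<in> E}"
  have NT: "N \<subseteq> T"
  proof
    fix k assume "k \<in> N"
    then have k: "{j, k} \<in> E" by (simp add: N_def)
    then have "k \<in> C" using closed[OF k] ij(2) by auto
    moreover have "k \<notin> S" using stable[OF ijS(2), of k] k by auto
    ultimately show "k \<in> T" by (simp add: T_def)
  qed
  \<comment> \<open>Every edge of \<open>H'\<close> at \<open>j\<close> ends in \<open>N\<close>,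
    where both matchings are saturated. So \<open>H\<close> has more incidences with
    \<open>N\<close> than with \<open>j\<close>, hence an edge that meets \<open>N\<close> and
    avoids \<open>j\<close>.\<close>
  have "deg H' j \<le> (\<Sum>k\<in>N. deg H' k)"
  proof -
    have "deg H' j = (\<Sum>x\<in>{j}. deg H' x)" by simp
    also have "\<dots> \<le> (\<Sum>k\<in>N. deg H' k)"
      unfolding sum_deg[OF finite]
    proof (rule sum_mset_mono)
      fix e assume "e \<in># H'"
      then have e: "e \<in> E" using E by blast
      show "card (e \<inter> {j}) \<le> card (e \<inter> N)"
      proof (cases "j \<in> e")
        case True
        then have "e \<subseteq> C" using closed[OF e] ij(2) by blast
        from edge_obtain[OF e this] obtain x y where xy: "e = {x, y}" by metis
        then have "\<exists>k\<in>e. k \<in> N" using True e by (auto simp: N_def insert_commute)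
        then have "e \<inter> N \<noteq> {}" by blast
        then have "card (e \<inter> N) > 0" by (simp add: card_gt_0_iff)
        then show ?thesis using True by simp
      qed simp
    qed
    finally show ?thesis .
  qed
  also have "\<dots> = (\<Sum>k\<in>N. deg H k)"
    by (rule sum.cong) (use sat sat' NT in auto)
  finally have "deg H j < (\<Sum>k\<in>N. deg H k)" using ij(4) by simp
  then have lt: "(\<Sum>e\<in>#H. card (e \<inter> {j})) < (\<Sum>e\<in>#H. card (e \<inter> N))"
    using sum_deg[of "{j}" H] sum_deg[of N H] by simp
  have "\<exists>e\<in>#H. card (e \<inter> {j}) < card (e \<inter> N)"
  proof (rule ccontr)
    assume "\<not> ?thesis"
    then have "(\<Sum>e\<in>#H. card (e \<inter> N)) \<le> (\<Sum>e\<in>#H. card (e \<inter> {j}))"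
      by (intro sum_mset_mono) (simp add: not_less)
    with lt show False by simp
  qed
  then obtain e where e: "e \<in># H" "card (e \<inter> {j}) < card (e \<inter> N)" by blast
  then have "e \<inter> N \<noteq> {}" by auto
  then have "e \<subseteq> C" using closed E e(1) NT TC(1) by blast
  then obtain m k where mk: "m \<in> S" "k \<in> T" "e = {m, k}" using cross e(1) by blast
  have "m \<notin> N" using NT TC(2) mk(1) by blast
  then have kN: "k \<in> N" using \<open>e \<inter> N \<noteq> {}\<close> mk by auto
  have "m \<noteq> j"
  proof
    assume "m = j"
    then have "e \<inter> N = {k}" "e \<inter> {j} = {j}" using mk \<open>m \<notin> N\<close> kN by auto
    then show False using e(2) by simp
  qed
  have jk: "{j, k} \<in> E" using kN by (simp add: N_def)
  have mkH: "{m, k} \<in># H" using e mk by simp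
  then have mkE: "{m, k} \<in> E" using E by blast
  have sp: "deg H x + of_bool (x = j) \<le> c x" for x
    using ij(4) le(1)[of x] le(2)[of j] by (cases "x = j") auto
  \<comment> \<open>The alternating path \<open>i\<close>, \<open>l\<close>, \<open>j\<close> moves
    the unit by replacing a single edge.\<close>
  have direct: ?thesis if l: "{i, l} \<in># H" "{j, l} \<in> E" for l
  proof -
    have ilE: "{i, l} \<in> E" using E l by blast
    have eq: "deg {#{j, l}#} x + of_bool (x = i) = deg {#{i, l}#} x + of_bool (x = j)" for x
      using ilE l(2) by (simp del: deg_simps(2))
    have bd: "deg H x + deg {#{j, l}#} x \<le> c x + deg {#{i, l}#} x" for x
      using eq[of x] sp[of x] by linarith
    note r = max_b_matching_replace[OF H(1) _ _ bd]
    have sub: "{#{i, l}#} \<subseteq># H" "set_mset {#{j, l}#} \<subseteq> E" using l by auto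
    have d: "deg (H - {#{i, l}#} + {#{j, l}#}) x + of_bool (x = i) = deg H x + of_bool (x = j)" for x
      using r(3)[OF sub, of x] eq[of x] by linarith
    have "max_b_matching E c (H - {#{i, l}#} + {#{j, l}#})" by (rule r(2)[OF sub]) simp
    with d show ?thesis by blast
  qed
  show ?thesis
  proof (cases "m = i")
    case True
    then show ?thesis using direct[of k] mkH jk by blast
  next
    case False
    have "deg H i > 0" using ij(3) by simp
    then obtain e' where e': "e' \<in># H" "i \<in> e'" by (auto simp: deg_pos_iff)
    then have "e' \<subseteq> C" using closed E ij(1) by blast
    then obtain i' l where il: "i' \<in> S" "l \<in> T" "e' = {i', l}" using cross e'(1) by blast
    then have "i' = i" using e'(2) ijS TC(2) by auto
    then have ilH: "{i, l} \<in># H" using il e' by simp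
    show ?thesis
    proof (cases "{j, l} \<in> E")
      case True
      then show ?thesis using direct ilH by blast
    next
      case nj: False
      \<comment> \<open>As \<open>l\<close> misses \<open>j\<close>, it is adjacent to
        \<open>m\<close>, and the alternating path \<open>i\<close>, \<open>l\<close>,
        \<open>m\<close>, \<open>k\<close>, \<open>j\<close> replaces two edges.\<close>
      have ml: "{m, l} \<in> E" using far[OF ijS mk(1) il(2) \<open>i \<noteq> j\<close> _ _ nj] \<open>m \<noteq> j\<close> False by auto
      have ilE: "{i, l} \<in> E" using E ilH by blast
      have ne: "{i, l} \<noteq> {m, k}"
        using False mk il ijS TC(2) by (auto simp: doubleton_eq_iff)
      let ?K = "{#{i, l}, {m, k}#}" and ?L = "{#{m, l}, {j, k}#}"
      have eq: "deg ?L x + of_bool (x = i) = deg ?K x + of_bool (x = j)" for x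
        using ilE mkE ml jk by (simp del: deg_simps(2))
      have bd: "deg H x + deg ?L x \<le> c x + deg ?K x" for x
        using eq[of x] sp[of x] by linarith
      note r = max_b_matching_replace[OF H(1) _ _ bd]
      have sub: "?K \<subseteq># H" "set_mset ?L \<subseteq> E"
        using pair_subset_mset[OF ilH mkH ne] ml jk by auto
      have d: "deg (H - ?K + ?L) x + of_bool (x = i) = deg H x + of_bool (x = j)" for x
        using r(3)[OF sub, of x] eq[of x] by linarith
      have "max_b_matching E c (H - ?K + ?L)" by (rule r(2)[OF sub]) simp
      with d show ?thesis by blast
    qed
  qed
qed

lemma max_b_matching_exchange:
  assumes H: "max_b_matching E c H" "max_b_matching E c H'"
    and ij: "i \<in> C" "j \<in> C" "deg H i > deg H' i" "deg H j < deg H' j"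
  shows "\<exists>H''. max_b_matching E c H'' \<and> (\<forall>x. deg H'' x + of_bool (x = i) = deg H x + of_bool (x = j))"
proof (cases "\<exists>p\<in>C. \<exists>q\<in>C. spare c H p q")
  case True
  then obtain S where "certificate c H S" using certificate_exists[OF H(1)] by metis
  from certificate_exchange[OF H this ij] show ?thesis .
next
  case False
  have le: "deg K x \<le> c x" if "K = H \<or> K = H'" for K x using H that by (auto simp: max_b_matching_def b_matching_def)
  have j: "deg H j < c j" using ij(4) le[of H' j] by simp
  \<comment> \<open>A second unsaturated vertex would form a spare pair with \<open>j\<close>;
    likewise \<open>j\<close> lacks exactly one unit.\<close>
  have full: "deg H x = c x" if "x \<in> C" "x \<noteq> j" for x
    using False spare_distinct[of j x H c] le[of H x] le[of H] j ij(2) that by (metis nat_less_le)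
  have j1: "deg H j + 1 = c j" 
    using False spare_same[of H j c] le[of H] j ij(2) by force
  have "(\<Sum>x\<in>C. deg H x + of_bool (x = j)) = (\<Sum>x\<in>C. c x)"
    by (rule sum.cong) (use full j1 in auto)
  then have sum: "(\<Sum>x\<in>C. c x) = (\<Sum>x\<in>C. deg H x) + 1"
    using ij(2) by (simp add: sum.distrib sum_of_bool_eq)
  have i: "deg H' i < c i" using ij(3) le[of H i] by simp
  have "deg H' x + of_bool (x = i) \<le> c x" for x using i le[of H' x] by auto
  moreover have "(\<Sum>x\<in>C. deg H' x + of_bool (x = i)) = (\<Sum>x\<in>C. deg H' x) + 1"
    using ij(1) by (simp add: sum.distrib sum_of_bool_eq)
  then have "(\<Sum>x\<in>C. deg H' x + of_bool (x = i)) = (\<Sum>x\<in>C. c x)"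
    using sum sum_deg_eq[OF H] by simp
  \<comment> \<open>On \<open>C\<close> the degrees of \<open>H'\<close> add up to one less than the
    capacities, so the unit missing at \<open>i\<close> is the only one. Thus \<open>H'\<close>
    itself realises the exchanged vector on \<open>C\<close>.\<close>
  ultimately have H': "deg H' x + of_bool (x = i) = c x" if "x \<in> C" for x
    using sum_mono_inv[of "\<lambda>x. deg H' x + of_bool (x = i)" C c x] that by auto
  have "deg H x + of_bool (x = j) = c x" if "x \<in> C" for x using full j1 that by auto
  then have "deg (graft H H') x + of_bool (x = i) = deg H x + of_bool (x = j)" for x
    using deg_graft[of H H' x] H H' ij(1,2) by (auto simp: max_b_matching_def b_matching_def)
  then show ?thesis using max_graft[OF H] by blast
qed

end

section \<open>Toric ideals\<close>

text \<open>Monomials in the variables $z_w$ correspond to multisets of exponent vectors $w$.\<close>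

definition mset_of_exp :: "('m \<Rightarrow>\<^sub>0 nat) \<Rightarrow> 'm multiset" where
  "mset_of_exp \<beta> = (\<Sum>w\<in>Poly_Mapping.keys \<beta>. replicate_mset (Poly_Mapping.lookup \<beta> w) w)"

definition exp_of_mset :: "'m multiset \<Rightarrow> ('m \<Rightarrow>\<^sub>0 nat)" where
  "exp_of_mset M = (\<Sum>w\<in>#M. Poly_Mapping.single w 1)"

lemma count_mset_of_exp: "count (mset_of_exp \<beta>) w = Poly_Mapping.lookup \<beta> w"
proof -
  have "count (mset_of_exp \<beta>) w = (\<Sum>x\<in>Poly_Mapping.keys \<beta>. if w = x then Poly_Mapping.lookup \<beta> x else 0)"
    by (simp add: mset_of_exp_def count_sum count_replicate_mset eq_commute)
  also have "\<dots> = Poly_Mapping.lookup \<beta> w"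
    by (simp add: sum.delta' in_keys_iff)
  finally show ?thesis .
qed

lemma lookup_exp_of_mset: "Poly_Mapping.lookup (exp_of_mset M) w = count M w"
  by (induction M) (auto simp: exp_of_mset_def lookup_add lookup_single when_def)

lemma exp_of_mset_inverse [simp]: "mset_of_exp (exp_of_mset M) = M"
  by (rule multiset_eqI) (simp add: count_mset_of_exp lookup_exp_of_mset)

lemma mset_of_exp_inverse [simp]: "exp_of_mset (mset_of_exp \<beta>) = \<beta>"
  by (rule poly_mapping_eqI) (simp add: count_mset_of_exp lookup_exp_of_mset)

lemma mset_of_exp_add: "mset_of_exp (\<alpha> + \<beta>) = mset_of_exp \<alpha> + mset_of_exp \<beta>"
  by (rule multiset_eqI) (simp add: count_mset_of_exp lookup_add)

lemma exp_of_mset_add: "exp_of_mset (M + N) = exp_of_mset M + exp_of_mset N"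
  by (simp add: exp_of_mset_def)

lemma set_mset_of_exp: "set_mset (mset_of_exp \<beta>) = Poly_Mapping.keys \<beta>"
  by (auto simp: count_mset_of_exp in_keys_iff simp flip: count_greater_zero_iff)

lemma keys_exp_of_mset: "Poly_Mapping.keys (exp_of_mset M) = set_mset M"
  using set_mset_of_exp[of "exp_of_mset M"] by simp

section \<open>The toric map on monomials\<close>

definition toric_exp :: "(('v \<Rightarrow>\<^sub>0 nat) \<Rightarrow>\<^sub>0 nat) \<Rightarrow> ('v \<Rightarrow>\<^sub>0 nat)" where
  "toric_exp \<beta> = \<Sum>\<^sub># (mset_of_exp \<beta>)"

lemma toric_exp_add: "toric_exp (\<alpha> + \<beta>) = toric_exp \<alpha> + toric_exp \<beta>"
  by (simp add: toric_exp_def mset_of_exp_add)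

lemma prod_mset_xmon: "(\<Prod>w\<in>#M. xmon w) = xmon (\<Sum>\<^sub># M)"
  by (induction M) (simp_all add: xmon_def mult_single)

lemma prod_mset_sum_replicate:
  "finite A \<Longrightarrow> (\<Prod>w\<in>#(\<Sum>w\<in>A. replicate_mset (k w) w). f w) = (\<Prod>w\<in>A. f w ^ k w)"
  by (induction A rule: finite_induct) auto

lemma prod_xmon:
  "(\<Prod>w\<in>Poly_Mapping.keys \<beta>. xmon w ^ Poly_Mapping.lookup \<beta> w) = xmon (toric_exp \<beta>)"
  unfolding toric_exp_def prod_mset_xmon[symmetric] mset_of_exp_def
  by (rule prod_mset_sum_replicate[symmetric]) simp

lemma toric_pi_eq: "toric_pi p = (\<Sum>\<beta>\<in>Poly_Mapping.keys p. Poly_Mapping.single (toric_exp \<beta>) (Poly_Mapping.lookup p \<beta>))"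
  unfolding toric_pi_def prod_xmon by (simp add: xmon_def mult_single)

text \<open>Cancellation can shrink the support of a sum, so additivity is proved over a common
  finite index set.\<close>

lemma toric_pi_superset:
  assumes "finite A" "Poly_Mapping.keys p \<subseteq> A"
  shows "toric_pi p = (\<Sum>\<beta>\<in>A. Poly_Mapping.single (toric_exp \<beta>) (Poly_Mapping.lookup p \<beta>))"
  unfolding toric_pi_eq using assms by (intro sum.mono_neutral_left) (auto simp: in_keys_iff)

lemma toric_pi_add: "toric_pi (p + q) = toric_pi p + toric_pi q"
proof -
  let ?A = "Poly_Mapping.keys p \<union> Poly_Mapping.keys q"
  have "toric_pi (p + q) = (\<Sum>\<beta>\<in>?A. Poly_Mapping.single (toric_exp \<beta>) (Poly_Mapping.lookup (p + q) \<beta>))"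
    by (rule toric_pi_superset) (use keys_add[of p q] in auto)
  also have "\<dots> = toric_pi p + toric_pi q"
    by (simp add: lookup_add single_add sum.distrib toric_pi_superset[of ?A p] toric_pi_superset[of ?A q])
  finally show ?thesis .
qed

lemma toric_pi_zero: "toric_pi 0 = 0"
  by (simp add: toric_pi_eq)

lemma toric_pi_sum: "toric_pi (\<Sum>x\<in>A. f x) = (\<Sum>x\<in>A. toric_pi (f x))"
  by (induction A rule: infinite_finite_induct) (simp_all add: toric_pi_zero toric_pi_add)

lemma toric_pi_diff: "toric_pi (p - q) = toric_pi p - toric_pi q"
  using toric_pi_add[of "p - q" q] by simp

lemma toric_pi_single: "toric_pi (Poly_Mapping.single \<beta> k) = Poly_Mapping.single (toric_exp \<beta>) k"
  using toric_pi_superset[of "{\<beta>}" "Poly_Mapping.single \<beta> k"] by simp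

lemma poly_mapping_sum_singles:
  "p = (\<Sum>\<beta>\<in>Poly_Mapping.keys p. Poly_Mapping.single \<beta> (Poly_Mapping.lookup p \<beta>))"
  by (rule poly_mapping_eqI) (simp add: lookup_sum lookup_single when_def in_keys_iff sum.delta)

text \<open>The weak form of multiplicativity that suffices to kill every multiple of an exchange
  binomial.\<close>

lemma toric_pi_mult_zmon: "toric_pi (p * zmon \<alpha>) = toric_pi p * xmon (toric_exp \<alpha>)"
proof -
  have "toric_pi (p * zmon \<alpha>) = toric_pi ((\<Sum>\<beta>\<in>Poly_Mapping.keys p. Poly_Mapping.single \<beta> (Poly_Mapping.lookup p \<beta>)) * zmon \<alpha>)"
    using poly_mapping_sum_singles[of p] by simp
  also have "\<dots> = toric_pi p * xmon (toric_exp \<alpha>)"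
    by (simp add: sum_distrib_right zmon_def xmon_def mult_single toric_pi_sum toric_pi_single toric_exp_add toric_pi_eq[of p])
  finally show ?thesis .
qed

section \<open>Ideals over the ring in the variables \<open>z_w\<close>\<close>

lemma ideal_span_superset: "1 \<in> R \<Longrightarrow> s \<in> S \<Longrightarrow> s \<in> ideal_span R S"
  unfolding ideal_span_def by (intro CollectI exI[of _ "{s}"] exI[of _ "\<lambda>_. 1"]) auto

lemma ideal_span_zero: "0 \<in> ideal_span R S"
  unfolding ideal_span_def by (intro CollectI exI[of _ "{}"]) auto

lemma ideal_span_mult:
  assumes R: "\<And>a b. a \<in> R \<Longrightarrow> b \<in> R \<Longrightarrow> a * b \<in> R" and "r \<in> R" "p \<in> ideal_span R S"
  shows "r * p \<in> ideal_span R S"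
proof -
  obtain F c where "finite F" "F \<subseteq> S" "\<forall>s\<in>F. c s \<in> R" "p = (\<Sum>s\<in>F. c s * s)"
    using assms(3) unfolding ideal_span_def by blast
  then show ?thesis unfolding ideal_span_def using R assms(2)
    by (intro CollectI exI[of _ F] exI[of _ "\<lambda>s. r * c s"]) (auto simp: sum_distrib_left mult.assoc)
qed

lemma ideal_span_add:
  assumes R: "0 \<in> R" "\<And>a b. a \<in> R \<Longrightarrow> b \<in> R \<Longrightarrow> a + b \<in> R"
    and "p \<in> ideal_span R S" "q \<in> ideal_span R S"
  shows "p + q \<in> ideal_span R S"
proof -
  obtain F c where F: "finite F" "F \<subseteq> S" "\<forall>s\<in>F. c s \<in> R" "p = (\<Sum>s\<in>F. c s * s)"
    using assms(3) unfolding ideal_span_def by blast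
  obtain G d where G: "finite G" "G \<subseteq> S" "\<forall>s\<in>G. d s \<in> R" "q = (\<Sum>s\<in>G. d s * s)"
    using assms(4) unfolding ideal_span_def by blast
  let ?c = "\<lambda>s. if s \<in> F then c s else 0" and ?d = "\<lambda>s. if s \<in> G then d s else 0"
  have "p = (\<Sum>s\<in>F \<union> G. ?c s * s)"
    unfolding F(4) using F(1) G(1) by (intro sum.mono_neutral_cong_left) auto
  moreover have "q = (\<Sum>s\<in>F \<union> G. ?d s * s)"
    unfolding G(4) using F(1) G(1) by (intro sum.mono_neutral_cong_left) auto
  ultimately have "p + q = (\<Sum>s\<in>F \<union> G. (?c s + ?d s) * s)"
    by (simp add: distrib_right sum.distrib)
  moreover have "\<forall>s\<in>F \<union> G. ?c s + ?d s \<in> R" using F(3) G(3) R by auto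
  ultimately show ?thesis unfolding ideal_span_def using F(1,2) G(1,2)
    by (intro CollectI exI[of _ "F \<union> G"] exI[of _ "\<lambda>s. ?c s + ?d s"]) blast
qed

lemma Tring_single: "Poly_Mapping.keys \<beta> \<subseteq> B \<Longrightarrow> Poly_Mapping.single \<beta> k \<in> Tring B"
  by (simp add: Tring_def)

lemma Tring_zero: "0 \<in> Tring B"
  by (simp add: Tring_def)

lemma Tring_one: "1 \<in> Tring B"
  by (simp add: Tring_def)

lemma Tring_add: "p \<in> Tring B \<Longrightarrow> q \<in> Tring B \<Longrightarrow> p + q \<in> Tring B"
  unfolding Tring_def using keys_add[of p q] by blast

lemma Tring_mult:
  assumes "p \<in> Tring B" "q \<in> Tring B"
  shows "p * q \<in> Tring B"
  unfolding Tring_def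
proof (intro CollectI ballI)
  fix \<beta> assume "\<beta> \<in> Poly_Mapping.keys (p * q)"
  then obtain a b where ab: "\<beta> = a + b" "a \<in> Poly_Mapping.keys p" "b \<in> Poly_Mapping.keys q"
    using keys_mult[of p q] by blast
  then have "Poly_Mapping.keys a \<subseteq> B" "Poly_Mapping.keys b \<subseteq> B" using assms by (auto simp: Tring_def)
  then show "Poly_Mapping.keys \<beta> \<subseteq> B" using keys_add[of a b] ab(1) by blast
qed

lemma Tring_uminus: "p \<in> Tring B \<Longrightarrow> - p \<in> Tring B"
  by (simp add: Tring_def)

lemma exch_equiv_span:
  assumes "exch_equiv B M N"
  shows "zmon (exp_of_mset M) - zmon (exp_of_mset N) \<in> ideal_span (Tring B) (sym_exch B :: (_ \<Rightarrow>\<^sub>0 'k::field) set)"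
    (is "_ \<in> ?I")
  using assms
proof induction
  case (exch u v u' v' i j)
  then have "zmon (Poly_Mapping.single u 1 + Poly_Mapping.single v 1)
      - zmon (Poly_Mapping.single u' 1 + Poly_Mapping.single v' 1) \<in> (sym_exch B :: (_ \<Rightarrow>\<^sub>0 'k) set)"
    unfolding sym_exch_def by blast
  then show ?case unfolding exp_of_mset_def
    by (simp add: ideal_span_superset Tring_one)
next
  case (refl M)
  show ?case by (simp add: ideal_span_zero)
next
  case (sym M N)
  from ideal_span_mult[OF Tring_mult Tring_uminus[OF Tring_one] sym.IH] show ?case by simp
next
  case (trans M N L)
  from ideal_span_add[OF Tring_zero Tring_add trans.IH] show ?case by simp
next
  case (add M N L)
  have "zmon (exp_of_mset L) \<in> Tring B"
    unfolding zmon_def by (rule Tring_single) (simp add: keys_exp_of_mset add.hyps)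
  from ideal_span_mult[OF Tring_mult this add.IH] show ?case
    by (simp add: exp_of_mset_add zmon_def mult_single right_diff_distrib add.commute)
qed

text \<open>Replacing every monomial of \<open>p\<close> by a representative of its fiber changes
  \<open>p\<close> by multiples of binomials in the span. The coefficients that collect at a
  representative are a coefficient of \<open>toric_pi p\<close>, hence zero.\<close>

lemma toric_ideal_eq_span:
  fixes B :: "('v::finite \<Rightarrow>\<^sub>0 nat) set"
  assumes B: "strong_exch B \<kappa>" and deg: "\<And>u. u \<in> B \<Longrightarrow> wt u UNIV = d" "d > 0"
  shows "(toric_ideal B :: (_ \<Rightarrow>\<^sub>0 'k::field) set) = ideal_span (Tring B) (sym_exch B)" (is "_ = ?I")
proof (intro equalityI subsetI)
  fix p :: "(('v \<Rightarrow>\<^sub>0 nat) \<Rightarrow>\<^sub>0 nat) \<Rightarrow>\<^sub>0 'k"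
  assume "p \<in> toric_ideal B"
  then have p: "p \<in> Tring B" "toric_pi p = 0" by (auto simp: toric_ideal_def)
  let ?K = "Poly_Mapping.keys p"
  \<comment> \<open>\<open>g\<close> depends only on the image exponent, so all monomials of one
    fiber share a representative.\<close>
  define g where "g a = (SOME \<beta>. \<beta> \<in> ?K \<and> toric_exp \<beta> = a)" for a
  have g: "g (toric_exp \<beta>) \<in> ?K" "toric_exp (g (toric_exp \<beta>)) = toric_exp \<beta>" if "\<beta> \<in> ?K" for \<beta>
    using someI[of "\<lambda>\<beta>'. \<beta>' \<in> ?K \<and> toric_exp \<beta>' = toric_exp \<beta>" \<beta>] that unfolding g_def by simp_all
  have diff: "zmon \<beta> - zmon (g (toric_exp \<beta>)) \<in> ?I" if "\<beta> \<in> ?K" for \<beta>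
  proof -
    have "exch_equiv B (mset_of_exp \<beta>) (mset_of_exp (g (toric_exp \<beta>)))"
    proof (rule exch_equiv_same_sum[OF B _ _ _ deg])
      show "set_mset (mset_of_exp \<beta>) \<subseteq> B" "set_mset (mset_of_exp (g (toric_exp \<beta>))) \<subseteq> B"
        using p(1) that g(1)[OF that] unfolding set_mset_of_exp Tring_def by blast+
      show "\<Sum>\<^sub># (mset_of_exp \<beta>) = \<Sum>\<^sub># (mset_of_exp (g (toric_exp \<beta>)))"
        using g(2)[OF that] by (simp add: toric_exp_def)
    qed
    from exch_equiv_span[OF this] show ?thesis by simp
  qed
  have "(\<Sum>\<beta>\<in>?K. Poly_Mapping.single (g (toric_exp \<beta>)) (Poly_Mapping.lookup p \<beta>)) =
     (\<Sum>a\<in>toric_exp ` ?K. \<Sum>\<beta>\<in>{\<beta> \<in> ?K. toric_exp \<beta> = a}. Poly_Mapping.single (g (toric_exp \<beta>)) (Poly_Mapping.lookup p \<beta>))"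
    by (rule sum.image_gen) simp
  also have "\<dots> = (\<Sum>a\<in>toric_exp ` ?K. Poly_Mapping.single (g a) (Poly_Mapping.lookup (toric_pi p) a))"
  proof (rule sum.cong[OF HOL.refl])
    fix a
    have "(\<Sum>\<beta>\<in>A. Poly_Mapping.single (g a) (f \<beta>)) = Poly_Mapping.single (g a) (\<Sum>\<beta>\<in>A. f \<beta>)"
      for A and f :: "_ \<Rightarrow> 'k" by (induction A rule: infinite_finite_induct) (simp_all add: single_add)
    moreover have "Poly_Mapping.lookup (toric_pi p) a = (\<Sum>\<beta>\<in>{\<beta> \<in> ?K. toric_exp \<beta> = a}. Poly_Mapping.lookup p \<beta>)"
      unfolding toric_pi_eq lookup_sum lookup_single when_def
      by (simp add: sum.inter_filter)
    ultimately show "(\<Sum>\<beta>\<in>{\<beta> \<in> ?K. toric_exp \<beta> = a}. Poly_Mapping.single (g (toric_exp \<beta>)) (Poly_Mapping.lookup p \<beta>))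
        = Poly_Mapping.single (g a) (Poly_Mapping.lookup (toric_pi p) a)"
      by simp
  qed
  also have "\<dots> = 0" by (simp add: p(2))
  finally have zero: "(\<Sum>\<beta>\<in>?K. Poly_Mapping.single (g (toric_exp \<beta>)) (Poly_Mapping.lookup p \<beta>)) = 0" .
  have "p = (\<Sum>\<beta>\<in>?K. Poly_Mapping.single \<beta> (Poly_Mapping.lookup p \<beta>))
          - (\<Sum>\<beta>\<in>?K. Poly_Mapping.single (g (toric_exp \<beta>)) (Poly_Mapping.lookup p \<beta>))"
    unfolding zero using poly_mapping_sum_singles[of p] by simp
  also have "\<dots> = (\<Sum>\<beta>\<in>?K. Poly_Mapping.single 0 (Poly_Mapping.lookup p \<beta>) * (zmon \<beta> - zmon (g (toric_exp \<beta>))))"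
    by (simp add: zmon_def mult_single right_diff_distrib sum_subtractf)
  finally have eq: "p = (\<Sum>\<beta>\<in>?K. Poly_Mapping.single 0 (Poly_Mapping.lookup p \<beta>) * (zmon \<beta> - zmon (g (toric_exp \<beta>))))" .
  have "(\<Sum>\<beta>\<in>A. Poly_Mapping.single 0 (f \<beta>) * (zmon \<beta> - zmon (g (toric_exp \<beta>)))) \<in> ?I"
    if "A \<subseteq> ?K" for A and f :: "_ \<Rightarrow> 'k"
    using that
  proof (induction A rule: infinite_finite_induct)
    case (insert \<beta> A)
    have "Poly_Mapping.single 0 (f \<beta>) * (zmon \<beta> - zmon (g (toric_exp \<beta>))) \<in> ?I"
      by (rule ideal_span_mult[OF Tring_mult Tring_single diff]) (use insert.prems in auto)
    then show ?case using insert ideal_span_add[OF Tring_zero Tring_add] by simp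
  qed (simp_all add: ideal_span_zero)
  from this[OF subset_refl] show "p \<in> ?I" by (subst eq)
next
  fix p :: "(('v \<Rightarrow>\<^sub>0 nat) \<Rightarrow>\<^sub>0 nat) \<Rightarrow>\<^sub>0 'k"
  assume "p \<in> ?I"
  then obtain F c where F: "finite F" "F \<subseteq> sym_exch B" "\<forall>s\<in>F. c s \<in> Tring B" "p = (\<Sum>s\<in>F. c s * s)"
    unfolding ideal_span_def by blast
  have gen: "s \<in> Tring B \<and> toric_pi (q * s) = 0" if s: "s \<in> sym_exch B" for s q :: "(('v \<Rightarrow>\<^sub>0 nat) \<Rightarrow>\<^sub>0 nat) \<Rightarrow>\<^sub>0 'k"
  proof -
    obtain u v u' v' \<xi> \<rho> where uv: "s = zmon (Poly_Mapping.single u 1 + Poly_Mapping.single v 1)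
                 - zmon (Poly_Mapping.single u' 1 + Poly_Mapping.single v' 1)"
      "u \<in> B" "v \<in> B" "u' \<in> B" "v' \<in> B"
      "u' + Poly_Mapping.single \<xi> 1 = u + Poly_Mapping.single \<rho> 1"
      "v' + Poly_Mapping.single \<rho> 1 = v + Poly_Mapping.single \<xi> 1"
      using s unfolding sym_exch_def by blast
    have two: "Poly_Mapping.single a 1 + Poly_Mapping.single b 1 = exp_of_mset {#a, b#}" for a b :: "'v \<Rightarrow>\<^sub>0 nat"
      by (simp add: exp_of_mset_def)
    have "(u' + v') + (Poly_Mapping.single \<xi> 1 + Poly_Mapping.single \<rho> 1)
        = (u' + Poly_Mapping.single \<xi> 1) + (v' + Poly_Mapping.single \<rho> 1)" by (simp only: ac_simps)
    also have "\<dots> = (u + v) + (Poly_Mapping.single \<xi> 1 + Poly_Mapping.single \<rho> 1)"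
      unfolding uv(6,7) by (simp only: ac_simps)
    finally have "u' + v' = u + v" by simp
    then have e: "toric_exp (exp_of_mset {#u', v'#}) = toric_exp (exp_of_mset {#u, v#})"
      by (simp add: toric_exp_def)
    have "zmon (exp_of_mset {#a, b#}) \<in> (Tring B :: (_ \<Rightarrow>\<^sub>0 'k) set)" if "a \<in> B" "b \<in> B" for a b
      unfolding zmon_def by (rule Tring_single) (use that in \<open>simp add: keys_exp_of_mset\<close>)
    then have "s \<in> Tring B" unfolding uv(1) two diff_conv_add_uminus
      using uv(2-5) by (intro Tring_add Tring_uminus) auto
    moreover have "toric_pi (q * s) = 0"
      unfolding uv(1) two right_diff_distrib toric_pi_diff toric_pi_mult_zmon e by simp
    ultimately show ?thesis ..
  qed
  have "(\<Sum>s\<in>A. c s * s) \<in> Tring B" if "A \<subseteq> F" for A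
    using that
    by (induction A rule: infinite_finite_induct)
      (use F(2,3) gen in \<open>auto intro!: Tring_zero Tring_add Tring_mult\<close>)
  moreover have "toric_pi p = 0"
    unfolding F(4) toric_pi_sum using gen F(2) by (intro sum.neutral) blast
  ultimately show "p \<in> toric_ideal B" using F(4) by (simp add: toric_ideal_def)
qed

section \<open>Bounded powers of edge ideals\<close>

definition deg_exp :: "('v::finite) set multiset \<Rightarrow> ('v \<Rightarrow>\<^sub>0 nat)" where
  "deg_exp H = Abs_poly_mapping (deg H)"

lemma lookup_deg_exp [simp]: "Poly_Mapping.lookup (deg_exp H) = deg H"
  by (simp add: deg_exp_def)

lemma ideal_span_empty: "ideal_span R {} = {0}"
  by (auto simp: ideal_span_def)

text \<open>The support criterion for monomial ideals: multiplying by a polynomial only adds to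
  exponents, so an upward closed set \<open>U\<close> keeps all supports.\<close>

lemma ideal_span_keys:
  fixes S :: "('a::comm_monoid_add \<Rightarrow>\<^sub>0 'k::comm_ring_1) set"
  assumes "p \<in> ideal_span R S" and S: "\<And>s. s \<in> S \<Longrightarrow> Poly_Mapping.keys s \<subseteq> U"
    and U: "\<And>t u. t \<in> U \<Longrightarrow> u + t \<in> U"
  shows "Poly_Mapping.keys p \<subseteq> U"
proof -
  obtain F c where F: "finite F" "F \<subseteq> S" "p = (\<Sum>s\<in>F. c s * s)"
    using assms(1) unfolding ideal_span_def by blast
  have "Poly_Mapping.keys (\<Sum>s\<in>A. c s * s) \<subseteq> U" if "finite A" "A \<subseteq> F" for A
    using that
  proof (induction A rule: finite_induct)
    case (insert s A)
    have s: "s \<in> S" using insert.prems F(2) by blast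
    have "Poly_Mapping.keys (c s * s) \<subseteq> U"
      using keys_mult[of "c s" s] S[OF s] U by blast
    moreover have "Poly_Mapping.keys (\<Sum>s\<in>A. c s * s) \<subseteq> U" using insert by simp
    ultimately show ?case
      using insert.hyps keys_add[of "c s * s" "\<Sum>s\<in>A. c s * s"] by auto
  qed simp
  with F show ?thesis by blast
qed

text \<open>The exponents of the monomials in the \<^term>\<open>q\<close>-th power of the edge ideal.\<close>

definition upset :: "'v set set \<Rightarrow> nat \<Rightarrow> ('v \<Rightarrow>\<^sub>0 nat) set" where
  "upset E q = {t. \<exists>H. set_mset H \<subseteq> E \<and> size H = q \<and> (\<forall>x. deg H x \<le> Poly_Mapping.lookup t x)}"

lemma upset_add: "t \<in> upset E q \<Longrightarrow> u + t \<in> upset E q"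
  unfolding upset_def by (auto simp: lookup_add intro: trans_le_add2)

lemma upset_add_Suc:
  assumes "s \<in> upset E 1" "t \<in> upset E q"
  shows "s + t \<in> upset E (Suc q)"
proof -
  obtain H where H: "set_mset H \<subseteq> E" "size H = 1" "\<forall>x. deg H x \<le> Poly_Mapping.lookup s x"
    using assms(1) unfolding upset_def by blast
  obtain H' where H': "set_mset H' \<subseteq> E" "size H' = q" "\<forall>x. deg H' x \<le> Poly_Mapping.lookup t x"
    using assms(2) unfolding upset_def by blast
  have "set_mset (H + H') \<subseteq> E" "size (H + H') = Suc q"
    "\<forall>x. deg (H + H') x \<le> Poly_Mapping.lookup (s + t) x"
    using H H' by (auto simp: lookup_add add_mono)
  then show ?thesis unfolding upset_def by blast
qed

lemma xvar_mult: "xvar u * xvar v = xmon (Poly_Mapping.single u 1 + Poly_Mapping.single v 1)"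
  by (simp add: xvar_def xmon_def mult_single)

lemma keys_edge_ideal:
  assumes "p \<in> edge_ideal E"
  shows "Poly_Mapping.keys p \<subseteq> upset E 1"
proof (rule ideal_span_keys[OF assms[unfolded edge_ideal_def]])
  fix s :: "('a \<Rightarrow>\<^sub>0 nat) \<Rightarrow>\<^sub>0 'b"
  assume "s \<in> {xvar u * xvar v | u v. {u, v} \<in> E}"
  then obtain u v where s: "s = xvar u * xvar v" and uv: "{u, v} \<in> E" by blast
  have "\<forall>x. deg {#{u, v}#} x \<le> Poly_Mapping.lookup (Poly_Mapping.single u 1 + Poly_Mapping.single v 1) x"
    by (auto simp: lookup_add lookup_single when_def)
  moreover have "set_mset {#{u, v}#} \<subseteq> E" "size {#{u, v}#} = 1" using uv by auto
  ultimately have "Poly_Mapping.single u 1 + Poly_Mapping.single v 1 \<in> upset E 1"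
    unfolding upset_def by blast
  then show "Poly_Mapping.keys s \<subseteq> upset E 1"
    unfolding s xvar_mult xmon_def by simp
qed (rule upset_add)

lemma keys_ideal_pow:
  fixes p :: "('v \<Rightarrow>\<^sub>0 nat) \<Rightarrow>\<^sub>0 'k::field"
  shows "p \<in> ideal_pow (edge_ideal E) q \<Longrightarrow> Poly_Mapping.keys p \<subseteq> upset E q"
proof (induction q arbitrary: p)
  case 0
  have "t \<in> upset E 0" for t unfolding upset_def by auto
  then show ?case by blast
next
  case (Suc q)
  show ?case
  proof (rule ideal_span_keys[OF Suc.prems[unfolded ideal_pow.simps]])
    fix s :: "('v \<Rightarrow>\<^sub>0 nat) \<Rightarrow>\<^sub>0 'k"
    assume "s \<in> {a * b | a b. a \<in> edge_ideal E \<and> b \<in> ideal_pow (edge_ideal E) q}"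
    then obtain a b where s: "s = a * b" "a \<in> edge_ideal E" "b \<in> ideal_pow (edge_ideal E) q" by blast
    show "Poly_Mapping.keys s \<subseteq> upset E (Suc q)"
      using keys_mult[of a b] keys_edge_ideal[OF s(2)] Suc.IH[OF s(3)] upset_add_Suc unfolding s(1) by blast
  qed (rule upset_add)
qed

lemma xmon_mult: "xmon a * xmon b = xmon (a + b)"
  by (simp add: xmon_def mult_single)

lemma xmon_in_ideal_pow:
  fixes E :: "'v::finite set set"
  assumes E: "simple_graph E"
  shows "set_mset H \<subseteq> E \<Longrightarrow> xmon (deg_exp H + t) \<in> ideal_pow (edge_ideal E :: (_ \<Rightarrow>\<^sub>0 'k::field) set) (size H)"
proof (induction H)
  case (add e H)
  then have e: "e \<in> E" by simp
  then obtain u v where uv: "e = {u, v}" "u \<noteq> v" using E unfolding simple_graph_def by (meson card_2_iff)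
  have "deg_exp (add_mset e H) + t = Poly_Mapping.single u 1 + Poly_Mapping.single v 1 + (deg_exp H + t)"
    by (rule poly_mapping_eqI) (use uv in \<open>auto simp: lookup_add lookup_single when_def\<close>)
  then have "xmon (deg_exp (add_mset e H) + t) = (xvar u * xvar v) * (xmon (deg_exp H + t) :: _ \<Rightarrow>\<^sub>0 'k)"
    by (simp add: xvar_mult xmon_mult)
  moreover have "xvar u * xvar v \<in> (edge_ideal E :: (_ \<Rightarrow>\<^sub>0 'k) set)"
    unfolding edge_ideal_def by (rule ideal_span_superset) (use e uv in auto)
  moreover have "xmon (deg_exp H + t) \<in> ideal_pow (edge_ideal E :: (_ \<Rightarrow>\<^sub>0 'k) set) (size H)" using add by simp
  ultimately show ?case
    unfolding size_add_mset ideal_pow.simps by (intro ideal_span_superset) auto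
qed simp

lemma xmon_in_trunc_iff:
  fixes E :: "'v::finite set set"
  assumes E: "simple_graph E"
  shows "xmon a \<in> trunc (ideal_pow (edge_ideal E :: (_ \<Rightarrow>\<^sub>0 'k::field) set) q) c \<longleftrightarrow>
    (\<exists>H. b_matching E c H \<and> size H = q \<and> (\<forall>x. deg H x \<le> Poly_Mapping.lookup a x))"
    (is "?L \<longleftrightarrow> ?R")
proof
  assume ?L
  let ?U = "{t. \<exists>H. b_matching E c H \<and> size H = q \<and> (\<forall>x. deg H x \<le> Poly_Mapping.lookup t x)}"
  have "Poly_Mapping.keys (xmon a :: _ \<Rightarrow>\<^sub>0 'k) \<subseteq> ?U"
  proof (rule ideal_span_keys[OF \<open>?L\<close>[unfolded trunc_def]])
    fix s assume "s \<in> {xmon b | b. xmon b \<in> ideal_pow (edge_ideal E :: (_ \<Rightarrow>\<^sub>0 'k) set) q \<and> (\<forall>v. Poly_Mapping.lookup b v \<le> c v)}"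
    then obtain b where b: "s = xmon b" "xmon b \<in> ideal_pow (edge_ideal E :: (_ \<Rightarrow>\<^sub>0 'k) set) q"
      "\<forall>v. Poly_Mapping.lookup b v \<le> c v" by blast
    have "b \<in> upset E q" using keys_ideal_pow[OF b(2)] by (simp add: xmon_def)
    then obtain H where H: "set_mset H \<subseteq> E" "size H = q" "\<forall>x. deg H x \<le> Poly_Mapping.lookup b x"
      unfolding upset_def by blast
    then have "b_matching E c H" unfolding b_matching_def using b(3) le_trans by blast
    then have "b \<in> ?U" using H by blast
    then show "Poly_Mapping.keys s \<subseteq> ?U" using b(1) by (simp add: xmon_def)
  next
    fix t u assume "t \<in> ?U"
    then show "u + t \<in> ?U" by (fastforce simp: lookup_add intro: trans_le_add2)
  qed
  then show ?R by (simp add: xmon_def)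
next
  assume ?R
  then obtain H where H: "b_matching E c H" "size H = q" "\<forall>x. deg H x \<le> Poly_Mapping.lookup a x" by blast
  \<comment> \<open>Only \<open>deg_exp H\<close> has to respect the bound \<open>c\<close>; the
    remaining factor of \<open>a\<close> is arbitrary. The subtraction is exact because
    \<open>deg H\<close> is at most \<open>a\<close>.\<close>
  have eq: "a = (a - deg_exp H) + deg_exp H"
    by (rule poly_mapping_eqI) (use H(3) in \<open>simp add: lookup_add lookup_minus\<close>)
  have "xmon (deg_exp H + 0) \<in> ideal_pow (edge_ideal E :: (_ \<Rightarrow>\<^sub>0 'k) set) q"
    using xmon_in_ideal_pow[OF E, of H 0] H(1,2) by (simp add: b_matching_def)
  then have "xmon (deg_exp H) \<in> trunc (ideal_pow (edge_ideal E :: (_ \<Rightarrow>\<^sub>0 'k) set) q) c"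
    unfolding trunc_def by (intro ideal_span_superset) (use H(1) in \<open>auto simp: b_matching_def\<close>)
  then have "xmon (a - deg_exp H) * xmon (deg_exp H) \<in> trunc (ideal_pow (edge_ideal E :: (_ \<Rightarrow>\<^sub>0 'k) set) q) c"
    unfolding trunc_def by (intro ideal_span_mult) auto
  then show ?L using eq by (simp add: xmon_mult)
qed

lemma trunc_nonzero_iff:
  fixes E :: "'v::finite set set"
  assumes E: "simple_graph E"
  shows "trunc (ideal_pow (edge_ideal E :: (_ \<Rightarrow>\<^sub>0 'k::field) set) q) c \<noteq> {0} \<longleftrightarrow>
    (\<exists>H. b_matching E c H \<and> size H = q)" (is "?T \<noteq> {0} \<longleftrightarrow> ?R")
proof
  assume "?T \<noteq> {0}"
  have "{xmon b :: _ \<Rightarrow>\<^sub>0 'k | b. xmon b \<in> ideal_pow (edge_ideal E :: (_ \<Rightarrow>\<^sub>0 'k) set) q \<and> (\<forall>v. Poly_Mapping.lookup b v \<le> c v)} \<noteq> {}"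
  proof
    assume "{xmon b :: _ \<Rightarrow>\<^sub>0 'k | b. xmon b \<in> ideal_pow (edge_ideal E :: (_ \<Rightarrow>\<^sub>0 'k) set) q \<and> (\<forall>v. Poly_Mapping.lookup b v \<le> c v)} = {}"
    then have "?T = {0}" unfolding trunc_def by (simp only: ideal_span_empty)
    with \<open>?T \<noteq> {0}\<close> show False by simp
  qed
  then obtain b where b: "xmon b \<in> ideal_pow (edge_ideal E :: (_ \<Rightarrow>\<^sub>0 'k) set) q" "\<forall>v. Poly_Mapping.lookup b v \<le> c v" by blast
  then have "xmon b \<in> ?T" unfolding trunc_def by (intro ideal_span_superset) auto
  then show ?R using xmon_in_trunc_iff[OF E] by blast
next
  assume ?R
  then obtain H where "b_matching E c H" "size H = q" by blast
  then have "xmon (deg_exp H) \<in> ?T" unfolding xmon_in_trunc_iff[OF E] by auto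
  moreover have "xmon (deg_exp H) \<noteq> (0 :: _ \<Rightarrow>\<^sub>0 'k)"
    unfolding xmon_def by (metis lookup_single_eq lookup_zero zero_neq_one)
  ultimately show "?T \<noteq> {0}" by blast
qed

lemma sum_deg_UNIV:
  fixes E :: "'v::finite set set"
  assumes "simple_graph E" "set_mset H \<subseteq> E"
  shows "(\<Sum>x\<in>UNIV. deg H x) = 2 * size H"
proof -
  have "(\<Sum>e\<in>#H. card (e \<inter> UNIV)) = (\<Sum>e\<in>#H. 2)"
    by (rule arg_cong[of _ _ sum_mset], rule image_mset_cong) (use assms in \<open>auto simp: simple_graph_def\<close>)
  then show ?thesis unfolding sum_deg[OF finite] by (simp add: sum_mset_constant)
qed

text \<open>The bound makes the \<open>GREATEST\<close> in \<open>delta\<close> well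
  defined.\<close>

lemma b_matching_size_bound:
  fixes E :: "'v::finite set set"
  assumes E: "simple_graph E" and "\<exists>H. b_matching E c H \<and> size H = q"
  shows "q \<le> (\<Sum>x\<in>UNIV. c x)"
proof -
  obtain H where H: "b_matching E c H" "size H = q" using assms(2) by blast
  have "2 * q = (\<Sum>x\<in>UNIV. deg H x)" using sum_deg_UNIV[OF E, of H] H by (simp add: b_matching_def)
  also have "\<dots> \<le> (\<Sum>x\<in>UNIV. c x)" by (rule sum_mono) (use H in \<open>simp add: b_matching_def\<close>)
  finally show ?thesis by simp
qed

lemma b_matching_size_le_delta:
  fixes E :: "'v::finite set set"
  assumes E: "simple_graph E" and H: "b_matching E c H"
  shows "size H \<le> delta (edge_ideal E :: (_ \<Rightarrow>\<^sub>0 'k::field) set) c"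
proof -
  let ?P = "\<lambda>q. \<exists>H. b_matching E c H \<and> size H = q"
  have "?P q \<Longrightarrow> q \<le> (\<Sum>x\<in>UNIV. c x)" for q
    by (rule b_matching_size_bound[OF E])
  then have "size H \<le> (GREATEST q. ?P q)" using H by (intro Greatest_le_nat[of ?P]) auto
  then show ?thesis unfolding delta_def trunc_nonzero_iff[OF E] .
qed

lemma max_b_matching_iff_delta:
  fixes E :: "'v::finite set set"
  assumes E: "simple_graph E"
  shows "max_b_matching E c H \<longleftrightarrow> b_matching E c H \<and> size H = delta (edge_ideal E :: (_ \<Rightarrow>\<^sub>0 'k::field) set) c"
proof -
  let ?P = "\<lambda>q. \<exists>H. b_matching E c H \<and> size H = q"
  have d: "delta (edge_ideal E :: (_ \<Rightarrow>\<^sub>0 'k) set) c = (GREATEST q. ?P q)"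
    unfolding delta_def trunc_nonzero_iff[OF E] ..
  have "?P 0" by (auto simp: b_matching_def)
  then have "?P (GREATEST q. ?P q)"
    by (rule GreatestI_nat[of ?P]) (rule b_matching_size_bound[OF E])
  then obtain H' where "b_matching E c H'" "size H' = delta (edge_ideal E :: (_ \<Rightarrow>\<^sub>0 'k) set) c"
    unfolding d by blast
  then show ?thesis
    using b_matching_size_le_delta[OF E, where 'k = 'k] unfolding max_b_matching_def by (metis le_antisym)
qed

text \<open>Degree vectors of maximum b-matchings all have the same total degree, so none properly
  divides another and each is a minimal generator.\<close>

lemma Bset_eq:
  fixes E :: "'v::finite set set"
  assumes E: "simple_graph E"
  shows "Bset (edge_ideal E :: (_ \<Rightarrow>\<^sub>0 'k::field) set) c = deg_exp ` {H. max_b_matching E c H}"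
    (is "?B = _")
proof -
  let ?I = "edge_ideal E :: (('v \<Rightarrow>\<^sub>0 nat) \<Rightarrow>\<^sub>0 'k) set"
  let ?T = "trunc (ideal_pow ?I (delta ?I c)) c"
  have T: "xmon a \<in> ?T \<longleftrightarrow> (\<exists>H. max_b_matching E c H \<and> mdvd (deg_exp H) a)" for a
    unfolding xmon_in_trunc_iff[OF E] max_b_matching_iff_delta[OF E, where 'k = 'k] mdvd_def
    by (simp add: conj_assoc)
  show ?thesis
  proof (intro equalityI subsetI)
    fix a assume "a \<in> ?B"
    then have a: "xmon a \<in> ?T" "\<And>b. xmon b \<in> ?T \<Longrightarrow> mdvd b a \<Longrightarrow> b = a"
      by (auto simp: Bset_def mingens_def)
    then obtain H where H: "max_b_matching E c H" "mdvd (deg_exp H) a" using T by blast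
    have "xmon (deg_exp H) \<in> ?T" unfolding T using H(1) by (auto simp: mdvd_def)
    then have "deg_exp H = a" using a(2) H(2) by blast
    then show "a \<in> deg_exp ` {H. max_b_matching E c H}" using H(1) by blast
  next
    fix a assume "a \<in> deg_exp ` {H. max_b_matching E c H}"
    then obtain H where H: "a = deg_exp H" "max_b_matching E c H" by blast
    have "b = a" if b: "xmon b \<in> ?T" "mdvd b a" for b
    proof -
      obtain H' where H': "max_b_matching E c H'" "mdvd (deg_exp H') b" using b(1) T by blast
      have le: "deg H' x \<le> Poly_Mapping.lookup b x" "Poly_Mapping.lookup b x \<le> deg H x" for x
        using H'(2) b(2) unfolding H(1) mdvd_def by simp_all
      have "size H' = size H" using H(2) H'(1) max_b_matching_iff_delta[OF E, where 'k = 'k] by metis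
      \<comment> \<open>Equal totals squeeze \<open>b\<close> between two degree vectors that must
        coincide.\<close>
      then have "(\<Sum>x\<in>UNIV. deg H' x) = (\<Sum>x\<in>UNIV. deg H x)"
        using sum_deg_UNIV[OF E] H(2) H'(1) by (simp add: max_b_matching_def b_matching_def)
      then have "deg H' x = deg H x" for x
        by (rule sum_mono_inv[OF _ le_trans[OF le] UNIV_I finite])
      then have "Poly_Mapping.lookup b x = deg H x" for x using le[of x] by simp
      then show ?thesis unfolding H(1) by (intro poly_mapping_eqI) simp
    qed
    moreover have "xmon a \<in> ?T" unfolding T using H by (auto simp: mdvd_def)
    ultimately show "a \<in> ?B" by (auto simp: Bset_def mingens_def)
  qed
qed

section \<open>From the graph hypotheses to the component structure\<close>

lemma cmp_minus_matching_structure: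
  fixes E :: "'v::finite set set"
  assumes E: "simple_graph E" and C: "cmp_minus_matching E C"
    and closed: "\<And>e. e \<in> E \<Longrightarrow> e \<inter> C \<noteq> {} \<Longrightarrow> e \<subseteq> C"
  obtains part :: "'v \<Rightarrow> 'v set" and M where "component_structure E C part M"
proof -
  obtain P M where P: "partition_on C P" and M: "M \<subseteq> cmp_edges P" "is_matching M"
    and eq: "{e \<in> E. e \<subseteq> C} = cmp_edges P - M"
    using C unfolding cmp_minus_matching_def by blast
  have uniq: "A = B" if "A \<in> P" "B \<in> P" "x \<in> A" "x \<in> B" for x A B
    using disjointD[OF partition_onD2[OF P] that(1,2)] that(3,4) by blast
  have ex1: "\<exists>!A. A \<in> P \<and> x \<in> A" if "x \<in> C" for x
  proof -
    obtain A where "A \<in> P" "x \<in> A" using partition_onD1[OF P] \<open>x \<in> C\<close> by blast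
    then show ?thesis using uniq by (intro ex1I[of _ A]) auto
  qed
  \<comment> \<open>A vertex of \<open>C\<close> is labelled by its own block of the
    partition.\<close>
  define part where "part x = (THE A. A \<in> P \<and> x \<in> A)" for x
  have part: "part x \<in> P" "x \<in> part x" if "x \<in> C" for x
    using theI'[OF ex1[OF that]] unfolding part_def by simp_all
  have part_eq: "part x = A" if "A \<in> P" "x \<in> A" for x A
  proof -
    have "x \<in> C" using partition_onD1[OF P] that by blast
    then show ?thesis using uniq[OF part(1) that(1) part(2) that(2)] by blast
  qed
  have cmp: "{x, y} \<in> cmp_edges P \<longleftrightarrow> part x \<noteq> part y" if "x \<in> C" "y \<in> C" for x y
  proof
    assume "{x, y} \<in> cmp_edges P"
    then obtain u v A B where uv: "{x, y} = {u, v}" "A \<in> P" "B \<in> P" "A \<noteq> B" "u \<in> A" "v \<in> B"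
      unfolding cmp_edges_def by blast
    have "part u \<noteq> part v" using part_eq[OF uv(2,5)] part_eq[OF uv(3,6)] uv(4) by simp
    moreover have "x = u \<and> y = v \<or> x = v \<and> y = u" using uv(1) by (simp add: doubleton_eq_iff)
    ultimately show "part x \<noteq> part y" by auto
  next
    assume "part x \<noteq> part y"
    then have "\<exists>A\<in>P. \<exists>B\<in>P. A \<noteq> B \<and> x \<in> A \<and> y \<in> B"
      using part[OF that(1)] part[OF that(2)] by (intro bexI[of _ "part x"] bexI[of _ "part y"]) simp_all
    then show "{x, y} \<in> cmp_edges P" unfolding cmp_edges_def by blast
  qed
  have "component_structure E C part M"
  proof
    show "card e = 2" if "e \<in> E" for e using E that by (simp add: simple_graph_def)
    show "{x, y} \<in> E \<longleftrightarrow> part x \<noteq> part y \<and> {x, y} \<notin> M" if "x \<in> C" "y \<in> C" for x y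
    proof -
      have "{x, y} \<in> E \<longleftrightarrow> {x, y} \<in> {e \<in> E. e \<subseteq> C}" using that by simp
      then show ?thesis unfolding eq using cmp[OF that] by simp
    qed
    show "part x \<noteq> part y" if "x \<in> C" "y \<in> C" "{x, y} \<in> M" for x y
      using cmp[OF that(1,2)] that(3) M(1) by blast
    show "y = z" if "{x, y} \<in> M" "{x, z} \<in> M" for x y z
    proof -
      have "{x, y} \<inter> {x, z} \<noteq> {}" by blast
      then have "{x, y} = {x, z}" using M(2)[unfolded is_matching_def, rule_format, OF that] by argo
      then show ?thesis by (auto simp: doubleton_eq_iff)
    qed
  qed (rule closed)
  then show thesis by (rule that)
qed

lemma component_sym:
  assumes "y \<in> component E x"
  shows "component E y = component E x"
proof -
  have "symp (adj E)" by (rule sympI) (simp add: adj_def insert_commute)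
  then have "symp (adj E)\<^sup>*\<^sup>*" by (rule symp_rtranclp)
  moreover have xy: "(adj E)\<^sup>*\<^sup>* x y" using assms by (simp add: component_def)
  ultimately have yx: "(adj E)\<^sup>*\<^sup>* y x" by (rule sympD)
  have "(adj E)\<^sup>*\<^sup>* y z \<longleftrightarrow> (adj E)\<^sup>*\<^sup>* x z" for z
    using rtranclp_trans[OF xy] rtranclp_trans[OF yx] by metis
  then show ?thesis unfolding component_def by (rule Collect_cong)
qed

text \<open>The fibres of \<open>component E\<close> are the components, so this map can serve as
  the labelling \<open>\<kappa>\<close>.\<close>

lemma component_class: "{x. component E x = component E i} = component E i"
proof -
  have "component E x = component E i \<longleftrightarrow> x \<in> component E i" for x
  proof
    assume "component E x = component E i"
    moreover have "x \<in> component E x" by (simp add: component_def)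
    ultimately show "x \<in> component E i" by simp
  qed (rule component_sym)
  then show ?thesis by simp
qed

lemma component_closed:
  assumes "simple_graph E" "e \<in> E" "e \<inter> component E i \<noteq> {}"
  shows "e \<subseteq> component E i"
proof -
  have "card e = 2" using assms by (simp add: simple_graph_def)
  then obtain x y where e: "e = {x, y}" by (meson card_2_iff)
  have "adj E x y" "adj E y x" using assms(2) e by (simp_all add: adj_def insert_commute)
  moreover have "x \<in> component E i \<or> y \<in> component E i" using assms(3) e by blast
  ultimately have "x \<in> component E i \<and> y \<in> component E i"
    unfolding component_def mem_Collect_eq by (metis rtranclp.rtrancl_into_rtrancl)
  then show ?thesis unfolding e by simp
qed

theorem theorem4p3:
  fixes E :: "('v::finite) set set" and c :: "'v \<Rightarrow> nat"
  assumes "simple_graph E"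
    and "no_isolated E"
    and "\<forall>v. c v > 0"
    and "\<forall>v. cmp_minus_matching E (component E v)"
  shows "(toric_ideal (Bset (edge_ideal E :: (('v \<Rightarrow>\<^sub>0 nat) \<Rightarrow>\<^sub>0 'k::field) set) c)
           :: ((('v \<Rightarrow>\<^sub>0 nat) \<Rightarrow>\<^sub>0 nat) \<Rightarrow>\<^sub>0 'k) set)
         = ideal_span (Tring (Bset (edge_ideal E :: (('v \<Rightarrow>\<^sub>0 nat) \<Rightarrow>\<^sub>0 'k) set) c))
             (sym_exch (Bset (edge_ideal E :: (('v \<Rightarrow>\<^sub>0 nat) \<Rightarrow>\<^sub>0 'k) set) c))"
proof -
  let ?I = "edge_ideal E :: (('v \<Rightarrow>\<^sub>0 nat) \<Rightarrow>\<^sub>0 'k) set"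
  have parts: "\<exists>(part :: 'v \<Rightarrow> 'v set) M. component_structure E (component E i) part M" for i
    using cmp_minus_matching_structure[OF assms(1) assms(4)[rule_format, of i] component_closed[OF assms(1)]] by metis
  have "strong_exch (Bset ?I c) (component E)"
    unfolding strong_exch_def component_class Bset_eq[OF assms(1)]
  proof (intro conjI ballI allI impI)
    fix u v i assume "u \<in> deg_exp ` {H. max_b_matching E c H}" "v \<in> deg_exp ` {H. max_b_matching E c H}"
    then obtain H H' where H: "u = deg_exp H" "v = deg_exp H'" "max_b_matching E c H" "max_b_matching E c H'" by blast
    obtain part :: "'v \<Rightarrow> 'v set" and M where "component_structure E (component E i) part M"
      using parts by blast
    then interpret component_structure E "component E i" part M .
    show "wt u (component E i) = wt v (component E i)" using sum_deg_eq[OF H(3,4)] H(1,2) by simp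
    fix j assume j: "component E j = component E i" "Poly_Mapping.lookup v i < Poly_Mapping.lookup u i"
      "Poly_Mapping.lookup u j < Poly_Mapping.lookup v j"
    have "i \<in> component E i" "j \<in> component E i" using component_class[of E i] j(1) by auto
    then obtain H'' where H'': "max_b_matching E c H''"
      "\<forall>x. deg H'' x + of_bool (x = i) = deg H x + of_bool (x = j)"
      using max_b_matching_exchange[OF H(3,4), of i j] j(2,3) H(1,2) by auto
    have "deg_exp H'' + Poly_Mapping.single i 1 = u + Poly_Mapping.single j 1"
    proof (rule poly_mapping_eqI)
      fix x
      show "Poly_Mapping.lookup (deg_exp H'' + Poly_Mapping.single i 1) x = Poly_Mapping.lookup (u + Poly_Mapping.single j 1) x"
        using H''(2)[rule_format, of x] H(1)
        by (auto simp: lookup_add lookup_single when_def of_bool_def split: if_splits)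
    qed
    then show "\<exists>u'\<in>deg_exp ` {H. max_b_matching E c H}. u' + Poly_Mapping.single i 1 = u + Poly_Mapping.single j 1"
      using H''(1) by blast
  qed
  moreover have "wt u UNIV = 2 * delta ?I c" if u: "u \<in> Bset ?I c" for u
  proof -
    obtain H where H: "u = deg_exp H" "max_b_matching E c H"
      using u unfolding Bset_eq[OF assms(1)] by blast
    then have "b_matching E c H" "size H = delta ?I c"
      using max_b_matching_iff_delta[OF assms(1), where 'k = 'k] by blast+
    then show ?thesis using sum_deg_UNIV[OF assms(1), of H] H(1) by (simp add: b_matching_def)
  qed
  moreover have "2 * delta ?I c > 0"
  proof -
    obtain e where e: "e \<in> E" using assms(2) unfolding no_isolated_def by blast
    \<comment> \<open>A single edge fits under the positive capacities, so \<open>delta\<close> is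
      at least 1 and the common degree is positive.\<close>
    have "b_matching E c {#e#}" using e assms(3) by (auto simp: b_matching_def of_bool_def Suc_le_eq)
    from b_matching_size_le_delta[OF assms(1) this, where 'k = 'k] show ?thesis by simp
  qed
  ultimately show ?thesis by (rule toric_ideal_eq_span)
qed

end
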